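(* There is an algorithm that, given a finite stochastic game $\mathcal{G}$, decides whether $\mathcal{G}$ is stopping under fairness in time polynomial in the size of $\mathcal{G}$.
   Context: A stochastic game is a tuple $\mathcal{G}=(V,(V_1,V_2,V_P),\delta)$ where $V$ is a finite set of vertices, $V_1,V_2,V_P$ form a partition of $V$, and $\delta:V\times V\to[0,1]$ satisfies $\delta(v,v')\in\{0,1\}$ for $v\in V_1\cup V_2$, $v'\in V$, and $\delta(v,\cdot)$ is a probability distribution on $V$ for $v\in V_P$. Let $\mathrm{post}(v)=\{v'\mid \delta(v,v')>0\}$; it is assumed $\mathrm{post}(v)\neq\emptyset$ for all $v$. A vertex $v$ is terminal if $\delta(v,v)=1$ and $\delta(v,v')=0$ for $v'\neq v$; $T$ is the set of terminal vertices. A path is an infinite sequence $\omega=v_0v_1\dots$ with $\delta(v_k,v_{k+1})>0$ for all $k$; $\inf(\omega)$ is the set of vertices occurring infinitely often in $\omega$. A strategy for Player $i\in\{1,2\}$ is a function $\pi_i:V^*V_i\to\mathcal{D}(V)$ with $\pi_i(\hat\omega u)(u')>0$ only if $u'\in\mathrm{post}(u)$. Given strategies $\pi_1,\pi_2$ and initial vertex $v$, $\Pr^{\pi_1,\pi_2}_{\mathcal{G},v}$ is the induced probability measure on paths starting at $v$. $\Diamond T$ is the set of paths visiting $T$. Fair plays: $FP^2=\{\omega\mid \forall v'\in V_2:\ v'\in\inf(\omega)\Rightarrow \mathrm{post}(v')\subseteq\inf(\omega)\}$; a Player 2 strategy $\pi_2$ is fair if $\Pr^{\pi_1,\pi_2}_{\mathcal{G},u}(FP^2)=1$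 for every Player 1 strategy $\pi_1$ and every $u\in V$. $\mathcal{G}$ is stopping under fairness if $\Pr^{\pi_1,\pi_2}_{\mathcal{G},v}(\Diamond T)=1$ for all Player 1 strategies $\pi_1$, all fair Player 2 strategies $\pi_2$, and all $v\in V$. *)

theory Defs
  imports
    "HOL-Probability.Probability"
    "HOL-Library.Log_Nat"
    "HOL-Computational_Algebra.Polynomial"
begin

section \<open>Stochastic games\<close>

record 'v game =
  verts :: "'v set"
  verts1 :: "'v set"
  verts2 :: "'v set"
  vertsP :: "'v set"
  trans_prob :: "'v \<Rightarrow> 'v \<Rightarrow> real"

definition post :: "'v game \<Rightarrow> 'v \<Rightarrow> 'v set" where
  "post G v = {v' \<in> verts G. trans_prob G v v' > 0}"

definition stochastic_game :: "'v game \<Rightarrow> bool" where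
  "stochastic_game G \<longleftrightarrow>
     finite (verts G) \<and>
     verts1 G \<union> verts2 G \<union> vertsP G = verts G \<and>
     verts1 G \<inter> verts2 G = {} \<and> verts1 G \<inter> vertsP G = {} \<and> verts2 G \<inter> vertsP G = {} \<and>
     (\<forall>v \<in> verts G. \<forall>v' \<in> verts G. trans_prob G v v' \<in> {0..1}) \<and>
     (\<forall>v \<in> verts1 G \<union> verts2 G. \<forall>v' \<in> verts G. trans_prob G v v' \<in> {0, 1}) \<and>
     (\<forall>v \<in> vertsP G. (\<Sum>v' \<in> verts G. trans_prob G v v') = 1) \<and>
     (\<forall>v \<in> verts G. post G v \<noteq> {})"

definition terminal :: "'v game \<Rightarrow> 'v set" where
  "terminal G = {v \<in> verts G. trans_prob G v v = 1 \<and>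
     (\<forall>v' \<in> verts G. v' \<noteq> v \<longrightarrow> trans_prob G v v' = 0)}"

definition paths :: "'v game \<Rightarrow> (nat \<Rightarrow> 'v) set" where
  "paths G = {\<omega>. (\<forall>k. \<omega> k \<in> verts G) \<and> (\<forall>k. trans_prob G (\<omega> k) (\<omega> (Suc k)) > 0)}"

definition inf_verts :: "(nat \<Rightarrow> 'v) \<Rightarrow> 'v set" where
  "inf_verts \<omega> = {v. \<exists>\<^sub>\<infinity>k. \<omega> k = v}"


section \<open>Strategies and the induced measure\<close>

text \<open>A strategy is applied to the whole nonempty history, whose last entry is the current vertex;
  its values on other lists are irrelevant.\<close>

type_synonym 'v strategy = "'v list \<Rightarrow> 'v pmf"

definition strategy1 :: "'v game \<Rightarrow> 'v strategy \<Rightarrow> bool" where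
  "strategy1 G \<pi> \<longleftrightarrow>
     (\<forall>h \<in> lists (verts G). \<forall>u \<in> verts1 G. set_pmf (\<pi> (h @ [u])) \<subseteq> post G u)"

definition strategy2 :: "'v game \<Rightarrow> 'v strategy \<Rightarrow> bool" where
  "strategy2 G \<pi> \<longleftrightarrow>
     (\<forall>h \<in> lists (verts G). \<forall>u \<in> verts2 G. set_pmf (\<pi> (h @ [u])) \<subseteq> post G u)"

definition next_prob :: "'v game \<Rightarrow> 'v strategy \<Rightarrow> 'v strategy \<Rightarrow> 'v list \<Rightarrow> 'v \<Rightarrow> real" where
  "next_prob G \<pi>1 \<pi>2 h v' =
     (if last h \<in> verts1 G then pmf (\<pi>1 h) v'
      else if last h \<in> verts2 G then pmf (\<pi>2 h) v'
      else trans_prob G (last h) v')"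

text \<open>The kernel \<open>step_kernel G \<pi>1 \<pi>2 v i \<omega>\<close> is the distribution of the \<open>i\<close>-th vertex
  given the vertices \<open>\<omega> 0, \<dots>, \<omega> (i - 1)\<close>.\<close>

definition step_kernel ::
  "'v game \<Rightarrow> 'v strategy \<Rightarrow> 'v strategy \<Rightarrow> 'v \<Rightarrow> nat \<Rightarrow> (nat \<Rightarrow> 'v) \<Rightarrow> 'v measure" where
  "step_kernel G \<pi>1 \<pi>2 v i \<omega> =
     (if i = 0 then return (count_space (verts G)) v
      else point_measure (verts G) (\<lambda>v'. ennreal (next_prob G \<pi>1 \<pi>2 (map \<omega> [0..<i]) v')))"

text \<open>The Ionescu-Tulcea measure for these kernels, on the product sigma-algebra over
  \<open>UNIV \<rightarrow> verts G\<close>.\<close>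

definition path_measure ::
  "'v game \<Rightarrow> 'v strategy \<Rightarrow> 'v strategy \<Rightarrow> 'v \<Rightarrow> (nat \<Rightarrow> 'v) measure" where
  "path_measure G \<pi>1 \<pi>2 v =
     projective_family.lim UNIV
       (Ionescu_Tulcea.CI (step_kernel G \<pi>1 \<pi>2 v) (\<lambda>_. count_space (verts G)))
       (\<lambda>_. count_space (verts G))"

lemma Ionescu_Tulcea_step_kernel:
  assumes G: "stochastic_game G" and s1: "strategy1 G \<pi>1" and s2: "strategy2 G \<pi>2"
    and v: "v \<in> verts G"
  shows "Ionescu_Tulcea (step_kernel G \<pi>1 \<pi>2 v) (\<lambda>_. count_space (verts G))"
  unfolding Ionescu_Tulcea_def
proof (intro conjI allI impI)
  have fin: "finite (verts G)" using G by (simp add: stochastic_game_def)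
  have prob: "prob_space (step_kernel G \<pi>1 \<pi>2 v i \<omega>)"
    if \<omega>: "\<omega> \<in> space (PiM {0..<i} (\<lambda>_. count_space (verts G)))" for i \<omega>
  proof (cases "i = 0")
    case True
    then show ?thesis using v by (simp add: step_kernel_def prob_space_return)
  next
    case False
    then obtain j where i: "i = Suc j" by (cases i) auto
    let ?h = "map \<omega> [0..<i]"
    have split: "?h = map \<omega> [0..<j] @ [\<omega> j]" by (simp add: i)
    have mem: "\<omega> k \<in> verts G" if "k < i" for k
      using \<omega> that by (auto simp: space_PiM PiE_iff)
    then have h: "map \<omega> [0..<j] \<in> lists (verts G)" by (auto simp: i)
    have u: "\<omega> j \<in> verts G" using mem by (simp add: i)
    have nonneg: "next_prob G \<pi>1 \<pi>2 ?h v' \<ge> 0" if "v' \<in> verts G" for v'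
      using that u G by (auto simp: next_prob_def split stochastic_game_def)
    have "(\<Sum>v' \<in> verts G. next_prob G \<pi>1 \<pi>2 ?h v') = 1"
    proof -
      consider "\<omega> j \<in> verts1 G" | "\<omega> j \<in> verts2 G" "\<omega> j \<notin> verts1 G"
        | "\<omega> j \<in> vertsP G" "\<omega> j \<notin> verts1 G" "\<omega> j \<notin> verts2 G"
        using u G unfolding stochastic_game_def by blast
      then show ?thesis
      proof cases
        case 1
        then have "set_pmf (\<pi>1 ?h) \<subseteq> verts G"
          using s1 h unfolding strategy1_def split post_def by fast
        then show ?thesis using 1 fin by (simp add: next_prob_def split sum_pmf_eq_1)
      next
        case 2
        then have "set_pmf (\<pi>2 ?h) \<subseteq> verts G"
          using s2 h unfolding strategy2_def split post_def by fast
        then show ?thesis using 2 fin by (simp add: next_prob_def split sum_pmf_eq_1)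
      next
        case 3
        then show ?thesis using G by (simp add: next_prob_def split stochastic_game_def)
      qed
    qed
    then have "(\<Sum>v' \<in> verts G. ennreal (next_prob G \<pi>1 \<pi>2 ?h v')) = 1"
      using nonneg by (subst sum_ennreal) auto
    then show ?thesis
      using False fin
      by (intro prob_spaceI)
        (simp add: step_kernel_def space_point_measure emeasure_point_measure_finite)
  qed
  show "prob_space (step_kernel G \<pi>1 \<pi>2 v i \<omega>)"
    if "\<omega> \<in> space (PiM {0..<i} (\<lambda>_. count_space (verts G)))" for i \<omega>
    using that by (rule prob)
  show "step_kernel G \<pi>1 \<pi>2 v i \<in>
      PiM {0..<i} (\<lambda>_. count_space (verts G)) \<rightarrow>\<^sub>M subprob_algebra (count_space (verts G))" for i
  proof -
    have "PiM {0..<i} (\<lambda>_. count_space (verts G)) = count_space (PiE {0..<i} (\<lambda>_. verts G))"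
      using fin by (intro count_space_PiM_finite) (auto intro: countable_finite)
    moreover have "step_kernel G \<pi>1 \<pi>2 v i \<omega> \<in> space (subprob_algebra (count_space (verts G)))"
      if "\<omega> \<in> PiE {0..<i} (\<lambda>_. verts G)" for \<omega>
    proof -
      have "prob_space (step_kernel G \<pi>1 \<pi>2 v i \<omega>)"
        using that by (intro prob) (simp add: space_PiM)
      then show ?thesis
        by (auto simp: space_subprob_algebra prob_space_imp_subprob_space
            step_kernel_def sets_point_measure)
    qed
    ultimately show ?thesis by (simp add: Pi_iff)
  qed
qed


section \<open>Stopping under fairness\<close>

definition reach_terminal :: "'v game \<Rightarrow> (nat \<Rightarrow> 'v) set" where
  "reach_terminal G = {\<omega> \<in> paths G. \<exists>k. \<omega> k \<in> terminal G}"

definition fair_plays2 :: "'v game \<Rightarrow> (nat \<Rightarrow> 'v) set" where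
  "fair_plays2 G =
     {\<omega> \<in> paths G. \<forall>v' \<in> verts2 G. v' \<in> inf_verts \<omega> \<longrightarrow> post G v' \<subseteq> inf_verts \<omega>}"

definition fair_strategy2 :: "'v game \<Rightarrow> 'v strategy \<Rightarrow> bool" where
  "fair_strategy2 G \<pi>2 \<longleftrightarrow> strategy2 G \<pi>2 \<and>
     (\<forall>\<pi>1 u. strategy1 G \<pi>1 \<longrightarrow> u \<in> verts G \<longrightarrow>
        measure (path_measure G \<pi>1 \<pi>2 u) (fair_plays2 G) = 1)"

definition stopping_under_fairness :: "'v game \<Rightarrow> bool" where
  "stopping_under_fairness G \<longleftrightarrow>
     (\<forall>\<pi>1 \<pi>2 v. strategy1 G \<pi>1 \<longrightarrow> fair_strategy2 G \<pi>2 \<longrightarrow> v \<in> verts G \<longrightarrow>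
        measure (path_measure G \<pi>1 \<pi>2 v) (reach_terminal G) = 1)"


section \<open>Random access machines\<close>

text \<open>
  Unit-cost RAM with addition and truncated subtraction but no multiplication, so that registers
  grow by at most one bit per step. Such machines simulate Turing machines, and are simulated by
  them, with polynomial overhead when the size of an input is its total binary length. The input
  is a read-only list of numbers; all registers are initially zero.\<close>

datatype instr =
    Const nat nat      \<comment> \<open>\<open>r[d] := c\<close>\<close>
  | Move nat nat       \<comment> \<open>\<open>r[d] := r[a]\<close>\<close>
  | Add nat nat nat    \<comment> \<open>\<open>r[d] := r[a] + r[b]\<close>\<close>
  | Sub nat nat nat    \<comment> \<open>\<open>r[d] := r[a] - r[b]\<close>, truncated\<close>
  | Load nat nat       \<comment> \<open>\<open>r[d] := r[r[a]]\<close>\<close>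
  | Store nat nat      \<comment> \<open>\<open>r[r[d]] := r[a]\<close>\<close>
  | Read nat nat       \<comment> \<open>\<open>r[d] := input[r[a]]\<close>, zero beyond the end of the input\<close>
  | Jump nat           \<comment> \<open>\<open>pc := l\<close>\<close>
  | JumpZero nat nat   \<comment> \<open>\<open>if r[a] = 0 then pc := l\<close>\<close>

type_synonym ram = "instr list"
type_synonym ram_config = "nat \<times> (nat \<Rightarrow> nat)"

fun exec_instr :: "nat list \<Rightarrow> instr \<Rightarrow> ram_config \<Rightarrow> ram_config" where
  "exec_instr w (Const d c) (pc, r) = (Suc pc, r(d := c))"
| "exec_instr w (Move d a) (pc, r) = (Suc pc, r(d := r a))"
| "exec_instr w (Add d a b) (pc, r) = (Suc pc, r(d := r a + r b))"
| "exec_instr w (Sub d a b) (pc, r) = (Suc pc, r(d := r a - r b))"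
| "exec_instr w (Load d a) (pc, r) = (Suc pc, r(d := r (r a)))"
| "exec_instr w (Store d a) (pc, r) = (Suc pc, r(r d := r a))"
| "exec_instr w (Read d a) (pc, r) = (Suc pc, r(d := (if r a < length w then w ! r a else 0)))"
| "exec_instr w (Jump l) (pc, r) = (l, r)"
| "exec_instr w (JumpZero a l) (pc, r) = (if r a = 0 then l else Suc pc, r)"

definition ram_halted :: "ram \<Rightarrow> ram_config \<Rightarrow> bool" where
  "ram_halted P c \<longleftrightarrow> fst c \<ge> length P"

definition ram_step :: "ram \<Rightarrow> nat list \<Rightarrow> ram_config \<Rightarrow> ram_config" where
  "ram_step P w c = (if ram_halted P c then c else exec_instr w (P ! fst c) c)"

definition ram_run :: "ram \<Rightarrow> nat list \<Rightarrow> nat \<Rightarrow> ram_config" where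
  "ram_run P w t = (ram_step P w ^^ t) (0, \<lambda>_. 0)"

text \<open>The answer is read off register 0 of the halting configuration. Halted configurations are
  fixed by \<open>ram_step\<close>, so halting after exactly \<open>t\<close> steps includes halting earlier.\<close>

definition answers_within :: "ram \<Rightarrow> nat list \<Rightarrow> nat \<Rightarrow> bool \<Rightarrow> bool" where
  "answers_within P w t b \<longleftrightarrow>
     ram_halted P (ram_run P w t) \<and> snd (ram_run P w t) 0 = (if b then 1 else 0)"

definition input_size :: "nat list \<Rightarrow> nat" where
  "input_size w = (\<Sum>x \<leftarrow> w. max 1 (floorlog 2 x))"


section \<open>Games as inputs\<close>

definition owner_tag :: "'v game \<Rightarrow> 'v \<Rightarrow> nat" where
  "owner_tag G v = (if v \<in> verts1 G then 1 else if v \<in> verts2 G then 2 else 0)"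

text \<open>\<open>encodes w G\<close>: for some enumeration of the vertices, the word \<open>w\<close> consists of the number of
  vertices, their owners, and the transition matrix row by row, each entry given as a numerator
  followed by a nonzero denominator (not necessarily in lowest terms). A game has such
  an encoding iff its transition probabilities are rational.\<close>

definition encodes :: "nat list \<Rightarrow> 'v game \<Rightarrow> bool" where
  "encodes w G \<longleftrightarrow> (\<exists>vs num den.
     distinct vs \<and> set vs = verts G \<and>
     (\<forall>v \<in> verts G. \<forall>v' \<in> verts G.
        den v v' > 0 \<and> trans_prob G v v' = real (num v v') / real (den v v')) \<and>
     w = length vs # map (owner_tag G) vs @
         concat (map (\<lambda>v. concat (map (\<lambda>v'. [num v v', den v v']) vs)) vs))"

end

(* Call a set of nonterminal vertices a trap if every Player 1 vertex in it has some successor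
   in it and every other vertex in it has all its successors in it. Almost surely, the set of
   vertices visited infinitely often by a play is closed under all moves of Player 2 (by fairness)
   and of chance (by a Borel-Cantelli argument), and contains a successor of each of its
   elements; so it is a trap unless the play reaches a terminal vertex. Conversely, Player 1 can
   stay inside a nonempty trap forever against the uniform Player 2 strategy, which is fair. Hence
   a game is stopping under fairness iff it has no nonempty trap. The complement of the largest
   trap is computed by sweeping over all vertices as many times as there are vertices, and
   only the signs of the transition probabilities matter for this. *)
theory Submission
  imports Defs
begin

text \<open>Strategies may use the whole history, so the visits to a vertex are not independent
  trials; all that is available is a lower bound, uniform in the history, on the conditional
  probability of an edge. A supermartingale and Fatou's lemma exploit such a bound directly. It
  exists at chance vertices and for the uniform strategy. For an arbitrary fair strategy it may
  fail, but there fairness is already the wanted conclusion; for Player 1 a pigeonhole argument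
  supplies one recurring successor.

  The largest trap is a greatest fixed point, so its complement grows from the empty set.
  Monotonicity permits a single array of flags updated in place, and a round that changes anything
  adds a vertex, which bounds the number of rounds. A numerator is only tested for zero, so the
  length of the entries does not affect the number of steps. The input lists one owner per vertex,
  so a polynomial in the number of vertices is polynomial in the input size.\<close>

section \<open>The path measure\<close>

context Ionescu_Tulcea
begin

text \<open>The limit is known only through its marginals \<open>CI J\<close>; for an initial
  segment such a marginal is just the composition of the first \<open>n\<close> kernels.\<close>

lemma C_eq_distr_lim:
  "C 0 n (\<lambda>_. undefined) = distr PF.lim (PiM {0..<n} M) (\<lambda>x. restrict x {0..<n})"
proof -
  \<comment> \<open>\<open>up_to J\<close> is the least strict upper bound of \<open>J\<close>, so
    no kernel beyond the segment is involved.\<close>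
  have "up_to {0..<n} = n"
    using up_to_iff[of "{0..<n}" n] up_to_less[of "{0..<n}" "n - 1"] by (cases n) auto
  then show ?thesis
    using distr_C[of n n "\<lambda>_. undefined" 0] by (simp add: distr_lim CI_def)
qed

lemma nn_integral_lim_restrict:
  assumes [measurable]: "f \<in> borel_measurable (PiM {0..<n} M)"
  shows "(\<integral>\<^sup>+x. f (restrict x {0..<n}) \<partial>PF.lim) = (\<integral>\<^sup>+x. f x \<partial>C 0 n (\<lambda>_. undefined))"
  unfolding C_eq_distr_lim
  by (subst nn_integral_distr) (auto simp: measurable_cong_sets[OF PF.sets_lim])

text \<open>The tower property: integrate out the last coordinate first. The later expectation
  bounds rest on it.\<close>

lemma nn_integral_lim_Suc:
  assumes f[measurable]: "f \<in> borel_measurable (PiM {0..<Suc n} M)"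
  shows "(\<integral>\<^sup>+x. f (restrict x {0..<Suc n}) \<partial>PF.lim) =
    (\<integral>\<^sup>+x. (\<integral>\<^sup>+y. f ((restrict x {0..<n})(n := y)) \<partial>P n (restrict x {0..<n})) \<partial>PF.lim)"
proof -
  have "(\<integral>\<^sup>+x. f (restrict x {0..<Suc n}) \<partial>PF.lim) = (\<integral>\<^sup>+x. f x \<partial>C 0 (Suc n) (\<lambda>_. undefined))"
    by (rule nn_integral_lim_restrict) measurable
  also have "\<dots> = (\<integral>\<^sup>+x. (\<integral>\<^sup>+y. f y \<partial>eP n x) \<partial>C 0 n (\<lambda>_. undefined))"
    using nn_integral_bind[where B="PiM {0..<Suc n} M" and N="eP n" and M="C 0 n (\<lambda>_. undefined)"]
    by (simp add: measurable_cong_sets[OF sets_C])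
  also have "\<dots> = (\<integral>\<^sup>+x. (\<integral>\<^sup>+y. f y \<partial>eP n (restrict x {0..<n})) \<partial>PF.lim)"
    by (rule nn_integral_lim_restrict[symmetric])
      (rule nn_integral_measurable_subprob_algebra2[where N="PiM {0..<Suc n} M"], measurable)
  also have "\<dots> = (\<integral>\<^sup>+x. (\<integral>\<^sup>+y. f ((restrict x {0..<n})(n := y)) \<partial>P n (restrict x {0..<n})) \<partial>PF.lim)"
    by (intro nn_integral_cong nn_integral_eP) (auto simp: space_PiM)
  finally show ?thesis .
qed

end

section \<open>The play process of a fixed pair of strategies\<close>

locale play =
  fixes G :: "'v game" and \<pi>1 \<pi>2 :: "'v strategy" and v :: 'v
  assumes game: "stochastic_game G" and strat1: "strategy1 G \<pi>1" and strat2: "strategy2 G \<pi>2"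
    and init: "v \<in> verts G"
begin

sublocale Ionescu_Tulcea "step_kernel G \<pi>1 \<pi>2 v" "\<lambda>_. count_space (verts G)"
  using game strat1 strat2 init by (rule Ionescu_Tulcea_step_kernel)

abbreviation "play_measure \<equiv> path_measure G \<pi>1 \<pi>2 v"

lemma path_measure_eq_lim: "play_measure = PF.lim"
  by (simp add: path_measure_def)

lemma finite_verts: "finite (verts G)"
  using game by (simp add: stochastic_game_def)

lemma sets_play_measure[measurable_cong]:
  "sets play_measure = sets (PiM UNIV (\<lambda>_. count_space (verts G)))"
  by (simp add: path_measure_eq_lim)

lemma space_play_measure: "space play_measure = UNIV \<rightarrow> verts G"
  by (simp add: path_measure_eq_lim space_PiM PiE_UNIV_domain)

lemma PiM_finite_eq_count_space:
  "finite I \<Longrightarrow> PiM I (\<lambda>_. count_space (verts G)) = count_space (PiE I (\<lambda>_. verts G))"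
  using finite_verts by (intro count_space_PiM_finite) (auto intro: countable_finite)

text \<open>With finitely many vertices, a finite product of count spaces is again a count space, so
  every function of a finite history is measurable, however a strategy depends on it.\<close>

lemma measurable_prefix[measurable]:
  "(\<lambda>\<omega>. map \<omega> [0..<n]) \<in> play_measure \<rightarrow>\<^sub>M count_space UNIV"
proof -
  have "(\<lambda>x. map x [0..<n]) \<in> PiM {0..<n} (\<lambda>_. count_space (verts G)) \<rightarrow>\<^sub>M count_space UNIV"
    by (simp add: PiM_finite_eq_count_space)
  moreover have "(\<lambda>\<omega>. restrict \<omega> {0..<n}) \<in> play_measure \<rightarrow>\<^sub>M PiM {0..<n} (\<lambda>_. count_space (verts G))"
    by (simp add: measurable_cong_sets[OF sets_play_measure] measurable_restrict_subset)
  ultimately have "(\<lambda>\<omega>. map (restrict \<omega> {0..<n}) [0..<n]) \<in> play_measure \<rightarrow>\<^sub>M count_space UNIV"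
    by (rule measurable_compose[rotated])
  also have "(\<lambda>\<omega>. map (restrict \<omega> {0..<n}) [0..<n]) = (\<lambda>\<omega>. map \<omega> [0..<n])"
    by (auto simp: fun_eq_iff)
  finally show ?thesis .
qed

lemma measurable_vertex[measurable]: "(\<lambda>\<omega>. \<omega> k) \<in> play_measure \<rightarrow>\<^sub>M count_space UNIV"
proof -
  have "(\<lambda>\<omega>. last (map \<omega> [0..<Suc k])) \<in> play_measure \<rightarrow>\<^sub>M count_space UNIV"
    by (rule measurable_compose[OF measurable_prefix]) simp
  then show ?thesis by simp
qed

lemma measurable_edge:
  assumes "\<And>a b. g a b \<in> space N"
  shows "(\<lambda>\<omega>. g (\<omega> k) (\<omega> (Suc k))) \<in> play_measure \<rightarrow>\<^sub>M N"
proof -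
  have "(\<lambda>\<omega>. (\<lambda>xs. g (xs ! k) (xs ! Suc k)) (map \<omega> [0..<Suc (Suc k)])) \<in> play_measure \<rightarrow>\<^sub>M N"
    by (rule measurable_compose[OF measurable_prefix]) (simp add: assms)
  then show ?thesis by (simp add: nth_append)
qed

lemma prob_space_play_measure: "prob_space play_measure"
proof -
  \<comment> \<open>The total mass is read off the marginal on no coordinates at all.\<close>
  have "distr play_measure (PiM {0..<0} (\<lambda>_. count_space (verts G))) (\<lambda>x. restrict x {0..<0}) =
      C 0 0 (\<lambda>_. undefined)"
    by (simp only: C_eq_distr_lim path_measure_eq_lim)
  moreover have "prob_space (C 0 0 (\<lambda>_. undefined))"
    by (rule prob_space_C) simp
  ultimately show ?thesis
    using prob_space_distrD[of "\<lambda>x. restrict x {0..<0}" play_measure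
        "PiM {0..<0} (\<lambda>_. count_space (verts G))"]
    by (simp add: measurable_cong_sets[OF sets_play_measure] measurable_restrict_subset)
qed

sublocale play: prob_space play_measure
  by (rule prob_space_play_measure)

lemma prefix_in_lists: "\<omega> \<in> space play_measure \<Longrightarrow> map \<omega> [0..<n] \<in> lists (verts G)"
  by (auto simp: space_play_measure Pi_iff)

lemma next_prob_nonneg:
  assumes "xs \<in> lists (verts G)" "xs \<noteq> []" "y \<in> verts G"
  shows "0 \<le> next_prob G \<pi>1 \<pi>2 xs y"
proof -
  have "last xs \<in> verts G" using assms by (auto simp: in_lists_conv_set)
  then show ?thesis
    using game assms by (auto simp: next_prob_def stochastic_game_def)
qed

lemma next_prob_pos_imp_post:
  assumes xs: "xs \<in> lists (verts G)" "xs \<noteq> []" and pos: "0 < next_prob G \<pi>1 \<pi>2 xs y"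
    and y: "y \<in> verts G"
  shows "y \<in> post G (last xs)"
proof -
  obtain h u where xs_eq: "xs = h @ [u]" using xs(2) by (metis append_butlast_last_id)
  with xs have h: "h \<in> lists (verts G)" by auto
  show ?thesis
  proof (cases "u \<in> verts1 G \<or> u \<in> verts2 G")
    case True
    then show ?thesis
      using h pos strat1 strat2
      by (auto simp: next_prob_def xs_eq strategy1_def strategy2_def set_pmf_iff subset_iff split: if_splits)
  next
    case False
    with pos y show ?thesis by (simp add: next_prob_def xs_eq post_def)
  qed
qed

lemma sum_next_prob:
  assumes xs: "xs \<in> lists (verts G)" "xs \<noteq> []"
  shows "(\<Sum>y \<in> verts G. next_prob G \<pi>1 \<pi>2 xs y) = 1"
proof -
  obtain h u where xs_eq: "xs = h @ [u]" using xs(2) by (metis append_butlast_last_id)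
  with xs have h: "h \<in> lists (verts G)" and u: "u \<in> verts G" by auto
  consider "u \<in> verts1 G" | "u \<in> verts2 G" "u \<notin> verts1 G"
    | "u \<in> vertsP G" "u \<notin> verts1 G" "u \<notin> verts2 G"
    using u game unfolding stochastic_game_def by blast
  then show ?thesis
  proof cases
    case 1
    then have "set_pmf (\<pi>1 xs) \<subseteq> verts G"
      using strat1 h unfolding strategy1_def xs_eq post_def by fast
    then show ?thesis using 1 finite_verts by (simp add: next_prob_def xs_eq sum_pmf_eq_1)
  next
    case 2
    then have "set_pmf (\<pi>2 xs) \<subseteq> verts G"
      using strat2 h unfolding strategy2_def xs_eq post_def by fast
    then show ?thesis using 2 finite_verts by (simp add: next_prob_def xs_eq sum_pmf_eq_1)
  next
    case 3
    then show ?thesis using game by (simp add: next_prob_def xs_eq stochastic_game_def)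
  qed
qed

section \<open>One-step transition law\<close>

lemma AE_start: "AE \<omega> in play_measure. \<omega> 0 = v"
proof -
  let ?f = "\<lambda>x. indicator {x. x 0 \<noteq> v} x :: ennreal"
  have "(\<integral>\<^sup>+\<omega>. ?f (restrict \<omega> {0..<Suc 0}) \<partial>play_measure) =
      (\<integral>\<^sup>+\<omega>. (\<integral>\<^sup>+y. ?f ((restrict \<omega> {0..<0})(0 := y))
        \<partial>step_kernel G \<pi>1 \<pi>2 v 0 (restrict \<omega> {0..<0})) \<partial>play_measure)"
    unfolding path_measure_eq_lim
    by (rule nn_integral_lim_Suc) (simp add: PiM_finite_eq_count_space)
  also have "\<dots> = 0"
    using init by (simp add: step_kernel_def nn_integral_return indicator_def)
  finally have "AE \<omega> in play_measure. ?f (restrict \<omega> {0..<Suc 0}) = 0"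
    by (subst (asm) nn_integral_0_iff_AE) (auto simp: indicator_def)
  then show ?thesis by (auto simp: indicator_def)
qed

text \<open>The tower property for histories as lists, the form in which strategies see them.
  Histories have length at least 1 because kernel 0 is the point mass at the initial vertex and not
  a move.\<close>

lemma nn_integral_prefix_Suc:
  fixes g :: "'v list \<Rightarrow> ennreal"
  shows "(\<integral>\<^sup>+\<omega>. g (map \<omega> [0..<Suc (Suc n)]) \<partial>play_measure) =
    (\<integral>\<^sup>+\<omega>. (\<Sum>y\<in>verts G. ennreal (next_prob G \<pi>1 \<pi>2 (map \<omega> [0..<Suc n]) y) *
       g (map \<omega> [0..<Suc n] @ [y])) \<partial>play_measure)"
proof -
  let ?f = "\<lambda>x. g (map x [0..<Suc (Suc n)])"
  have cong: "map (restrict \<omega> {0..<m}) [0..<m] = map \<omega> [0..<m]" for \<omega> :: "nat \<Rightarrow> 'v" and m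
    by auto
  have cong': "map ((restrict \<omega> {0..<m})(m := y)) [0..<Suc m] = map \<omega> [0..<m] @ [y]"
    for \<omega> :: "nat \<Rightarrow> 'v" and m y
    by auto
  have "(\<integral>\<^sup>+\<omega>. ?f (restrict \<omega> {0..<Suc (Suc n)}) \<partial>play_measure) =
      (\<integral>\<^sup>+\<omega>. (\<integral>\<^sup>+y. ?f ((restrict \<omega> {0..<Suc n})(Suc n := y))
        \<partial>step_kernel G \<pi>1 \<pi>2 v (Suc n) (restrict \<omega> {0..<Suc n})) \<partial>play_measure)"
    unfolding path_measure_eq_lim
    by (rule nn_integral_lim_Suc) (simp add: PiM_finite_eq_count_space)
  then show ?thesis
    unfolding cong cong' step_kernel_def
    using finite_verts by (simp add: nn_integral_point_measure_finite del: upt_Suc)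
qed


text \<open>A move of conditional probability 0 contributes nothing to the one-step sum, and there
  are only countably many times at which it could occur.\<close>

lemma AE_next_prob_pos:
  "AE \<omega> in play_measure. \<forall>n. 0 < next_prob G \<pi>1 \<pi>2 (map \<omega> [0..<Suc n]) (\<omega> (Suc n))"
proof (rule AE_all_countable[THEN iffD2], rule allI)
  fix n
  let ?p = "next_prob G \<pi>1 \<pi>2"
  let ?g = "\<lambda>xs. indicator {xs. \<not> 0 < ?p (butlast xs) (last xs)} xs :: ennreal"
  have "(\<integral>\<^sup>+\<omega>. ?g (map \<omega> [0..<Suc (Suc n)]) \<partial>play_measure) = 0"
    unfolding nn_integral_prefix_Suc
  proof (subst nn_integral_cong[where v="\<lambda>_. 0"])
    fix \<omega> assume "\<omega> \<in> space play_measure"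
    show "(\<Sum>y\<in>verts G. ennreal (?p (map \<omega> [0..<Suc n]) y) * ?g (map \<omega> [0..<Suc n] @ [y])) = 0"
      by (intro sum.neutral) (auto simp: indicator_def ennreal_neg not_less simp del: upt_Suc)
  qed simp
  then have "AE \<omega> in play_measure. ?g (map \<omega> [0..<Suc (Suc n)]) = 0"
    by (subst (asm) nn_integral_0_iff_AE) (auto intro: measurable_compose[OF measurable_prefix] simp del: upt_Suc)
  then show "AE \<omega> in play_measure. 0 < ?p (map \<omega> [0..<Suc n]) (\<omega> (Suc n))"
    by (auto simp: indicator_def butlast_append)
qed

lemma AE_paths: "AE \<omega> in play_measure. \<omega> \<in> paths G"
  using AE_next_prob_pos AE_space
proof eventually_elim
  case (elim \<omega>)
  then have \<omega>: "\<omega> k \<in> verts G" for k by (auto simp: space_play_measure Pi_iff)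
  have "\<omega> (Suc k) \<in> post G (\<omega> k)" for k
    using next_prob_pos_imp_post[OF prefix_in_lists[OF elim(2)], of "Suc k" "\<omega> (Suc k)"] elim(1) \<omega>
    by simp
  with \<omega> show ?case by (auto simp: paths_def post_def)
qed

section \<open>Recurrence along edges of bounded probability\<close>

text \<open>The product of the weights \<open>fac\<close> along a play is a supermartingale, so it stays bounded; it
  tends to infinity on plays that visit \<open>u\<close> infinitely often but move from \<open>u\<close> to \<open>u'\<close>
  only finitely often.\<close>

lemma AE_inf_verts_step:
  assumes "0 < e" and u': "u' \<in> verts G"
    and bound: "\<And>h. h \<in> lists (verts G) \<Longrightarrow> u \<in> verts G \<Longrightarrow> e \<le> next_prob G \<pi>1 \<pi>2 (h @ [u]) u'"
  shows "AE \<omega> in play_measure. u \<in> inf_verts \<omega> \<longrightarrow> u' \<in> inf_verts \<omega>"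
proof -
  let ?p = "next_prob G \<pi>1 \<pi>2"
  \<comment> \<open>At \<open>u\<close> the conditional mean of the next weight is (1 - p) * (1 + e)
    with p \<ge> e, hence at most 1; the weight 0 on the edge to \<open>u'\<close> pays for the
    growth on all others.\<close>
  define fac :: "'v \<Rightarrow> 'v \<Rightarrow> real"
    where "fac a b = (if a = u then if b = u' then 0 else 1 + e else 1)" for a b
  \<comment> \<open>A single early move from \<open>u\<close> to \<open>u'\<close> would annihilate
    a product starting at 0, so the start \<open>n\<close> is left free, to be chosen beyond the
    last visit to \<open>u'\<close>.\<close>
  define W where "W n m \<omega> = (\<Prod>i\<in>{n..<m}. ennreal (fac (\<omega> i) (\<omega> (Suc i))))"
    for n m and \<omega> :: "nat \<Rightarrow> 'v"
  have fac_nonneg: "0 \<le> fac a b" for a b using \<open>0 < e\<close> by (simp add: fac_def)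
  have W_meas[measurable]: "W n m \<in> borel_measurable play_measure" for n m
    unfolding W_def by (intro borel_measurable_prod_ennreal measurable_edge) simp
  have drift: "(\<Sum>y\<in>verts G. ennreal (?p xs y) * ennreal (fac (last xs) y)) \<le> 1"
    if xs: "xs \<in> lists (verts G)" "xs \<noteq> []" for xs
  proof -
    have "(\<Sum>y\<in>verts G. ?p xs y * fac (last xs) y) \<le> 1"
    proof (cases "last xs = u")
      case True
      with xs have "xs = butlast xs @ [u]" "butlast xs \<in> lists (verts G)" "u \<in> verts G"
        by (auto simp: in_lists_conv_set dest: in_set_butlastD)
      with bound have e: "e \<le> ?p xs u'" by metis
      have "(\<Sum>y\<in>verts G. ?p xs y * fac (last xs) y) = (\<Sum>y\<in>verts G - {u'}. ?p xs y) * (1 + e)"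
        using finite_verts u' True
        by (simp add: sum.remove[of _ u'] fac_def sum_distrib_right)
      also have "(\<Sum>y\<in>verts G - {u'}. ?p xs y) = 1 - ?p xs u'"
        using finite_verts u' by (simp add: sum_diff1 sum_next_prob[OF xs])
      also have "(1 - ?p xs u') * (1 + e) \<le> (1 - e) * (1 + e)"
        using e \<open>0 < e\<close> by (intro mult_right_mono) auto
      also have "\<dots> \<le> 1" by (simp add: algebra_simps)
      finally show ?thesis .
    next
      case False
      then show ?thesis by (simp add: fac_def sum_next_prob[OF xs])
    qed
    then show ?thesis
      using xs by (simp add: ennreal_mult'[symmetric] next_prob_nonneg fac_nonneg sum_ennreal)
  qed
  have W_le: "(\<integral>\<^sup>+\<omega>. W n m \<omega> \<partial>play_measure) \<le> 1" for n m
  proof (induction m)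
    case 0
    then show ?case by (simp add: W_def play.emeasure_space_1)
  next
    case (Suc m)
    show ?case
    proof (cases "n \<le> m")
      case False
      then show ?thesis by (simp add: W_def play.emeasure_space_1)
    next
      case True
      \<comment> \<open>\<open>W n m\<close> is a function of the first \<open>m + 1\<close>
        vertices only, so it factors out of the sum over the next vertex.\<close>
      define g where "g xs = (\<Prod>i\<in>{n..<m}. ennreal (fac (xs ! i) (xs ! Suc i)))" for xs :: "'v list"
      have g: "g (map \<omega> [0..<Suc m] @ ys) = W n m \<omega>" for \<omega> ys
        by (auto simp: g_def W_def nth_append simp del: upt_Suc intro!: prod.cong)
      have "(\<integral>\<^sup>+\<omega>. W n (Suc m) \<omega> \<partial>play_measure) =
          (\<integral>\<^sup>+\<omega>. (\<lambda>xs. g xs * ennreal (fac (last (butlast xs)) (last xs)))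
            (map \<omega> [0..<Suc (Suc m)]) \<partial>play_measure)"
        using True g[of _ "[_]"] by (simp add: W_def butlast_append)
      also have "\<dots> = (\<integral>\<^sup>+\<omega>. W n m \<omega> * (\<Sum>y\<in>verts G. ennreal (?p (map \<omega> [0..<Suc m]) y) *
          ennreal (fac (last (map \<omega> [0..<Suc m])) y)) \<partial>play_measure)"
        by (subst nn_integral_prefix_Suc) (simp add: g sum_distrib_left mult_ac del: upt_Suc)
      also have "\<dots> \<le> (\<integral>\<^sup>+\<omega>. W n m \<omega> * 1 \<partial>play_measure)"
        by (intro nn_integral_mono mult_left_mono drift prefix_in_lists) auto
      finally show ?thesis using Suc by simp
    qed
  qed
  \<comment> \<open>Fatou's lemma takes the place of martingale convergence: the liminf has integral
    at most 1, so it is almost surely finite.\<close>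
  have "AE \<omega> in play_measure. \<forall>n. liminf (\<lambda>m. W n m \<omega>) \<noteq> \<infinity>"
  proof (rule AE_all_countable[THEN iffD2], rule allI, rule nn_integral_PInf_AE)
    fix n
    have "(\<integral>\<^sup>+\<omega>. liminf (\<lambda>m. W n m \<omega>) \<partial>play_measure) \<le> liminf (\<lambda>m. \<integral>\<^sup>+\<omega>. W n m \<omega> \<partial>play_measure)"
      by (rule nn_integral_liminf) measurable
    also have "\<dots> \<le> liminf (\<lambda>m. 1)"
      using W_le by (intro Liminf_mono) auto
    finally show "(\<integral>\<^sup>+\<omega>. liminf (\<lambda>m. W n m \<omega>) \<partial>play_measure) \<noteq> \<infinity>"
      by (auto simp: Liminf_const top_unique)
  qed measurable
  then show ?thesis
  proof eventually_elim
    case (elim \<omega>)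
    show ?case
    proof (rule impI, rule ccontr)
      assume "u \<in> inf_verts \<omega>" and "u' \<notin> inf_verts \<omega>"
      then obtain n where n: "\<And>k. n < k \<Longrightarrow> \<omega> k \<noteq> u'" and inf: "\<And>k. \<exists>l>k. \<omega> l = u"
        unfolding inf_verts_def INFM_nat by blast
      \<comment> \<open>After the last visit to \<open>u'\<close> no factor is below 1, so the
        liminf is a supremum, and each visit to \<open>u\<close> multiplies the product by 1 +
        e.\<close>
      have one_le: "1 \<le> fac (\<omega> i) (\<omega> (Suc i))" if "n \<le> i" for i
        using n[of "Suc i"] that \<open>0 < e\<close> by (auto simp: fac_def)
      have "incseq (\<lambda>m. W n m \<omega>)"
      proof (rule incseq_SucI)
        fix m show "W n m \<omega> \<le> W n (Suc m) \<omega>"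
          using mult_left_mono[of 1 "ennreal (fac (\<omega> m) (\<omega> (Suc m)))" "W n m \<omega>"] one_le[of m]
          by (cases "n \<le> m") (auto simp: W_def)
      qed
      then have SUP: "liminf (\<lambda>m. W n m \<omega>) = (SUP m. W n m \<omega>)"
        by (simp add: lim_imp_Liminf LIMSEQ_SUP)
      have grow: "\<exists>m\<ge>n. ennreal ((1 + e) ^ N) \<le> W n m \<omega>" for N
      proof (induction N)
        case 0
        have "ennreal ((1 + e) ^ 0) \<le> W n n \<omega>" by (simp add: W_def)
        then show ?case by blast
      next
        case (Suc N)
        then obtain m where m: "n \<le> m" "ennreal ((1 + e) ^ N) \<le> W n m \<omega>" by blast
        obtain l where l: "m < l" "\<omega> l = u" using inf by blast
        have "ennreal ((1 + e) ^ Suc N) = ennreal ((1 + e) ^ N) * ennreal (1 + e)"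
          using \<open>0 < e\<close> by (simp add: ennreal_mult' mult.commute)
        also have "\<dots> \<le> W n l \<omega> * ennreal (fac (\<omega> l) (\<omega> (Suc l)))"
        proof (intro mult_mono)
          show "ennreal ((1 + e) ^ N) \<le> W n l \<omega>"
            using m(2) incseqD[OF \<open>incseq _\<close>, of m l] l by (auto intro: order_trans)
          show "ennreal (1 + e) \<le> ennreal (fac (\<omega> l) (\<omega> (Suc l)))"
            using l m n[of "Suc l"] by (simp add: fac_def)
        qed auto
        also have "\<dots> = W n (Suc l) \<omega>"
          using l m by (simp add: W_def)
        finally show ?case using l m by (intro exI[of _ "Suc l"]) auto
      qed
      have "(SUP m. W n m \<omega>) \<noteq> \<infinity>"
        using elim[rule_format, of n] unfolding SUP .
      then obtain r where r: "(SUP m. W n m \<omega>) = ennreal r" "0 \<le> r"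
        by (cases "SUP m. W n m \<omega>") auto
      obtain N where N: "r < (1 + e) ^ N" using real_arch_pow[of "1 + e" r] \<open>0 < e\<close> by auto
      from grow obtain m where "ennreal ((1 + e) ^ N) \<le> W n m \<omega>" by blast
      also have "\<dots> \<le> ennreal r" unfolding r(1)[symmetric] by (rule SUP_upper) simp
      finally show False using N r by (simp add: ennreal_le_iff)
    qed
  qed
qed

text \<open>The bound may depend on the successor but not on the history; finitely many successors
  give finitely many null sets.\<close>

lemma AE_inf_verts_post:
  assumes bound: "\<And>y. y \<in> post G u \<Longrightarrow>
    \<exists>e>0. \<forall>h\<in>lists (verts G). e \<le> next_prob G \<pi>1 \<pi>2 (h @ [u]) y"
  shows "AE \<omega> in play_measure. u \<in> inf_verts \<omega> \<longrightarrow> post G u \<subseteq> inf_verts \<omega>"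
proof -
  have "finite (post G u)" using finite_verts by (simp add: post_def)
  moreover have "AE \<omega> in play_measure. u \<in> inf_verts \<omega> \<longrightarrow> y \<in> inf_verts \<omega>" if y: "y \<in> post G u" for y
    using bound[OF y] y by (auto intro: AE_inf_verts_step simp: post_def)
  ultimately have "AE \<omega> in play_measure. \<forall>y\<in>post G u. u \<in> inf_verts \<omega> \<longrightarrow> y \<in> inf_verts \<omega>"
    by (rule AE_finite_allI)
  then show ?thesis by eventually_elim blast
qed

lemma AE_vertsP_post:
  "AE \<omega> in play_measure. \<forall>u\<in>vertsP G. u \<in> inf_verts \<omega> \<longrightarrow> post G u \<subseteq> inf_verts \<omega>"
proof (rule AE_finite_allI)
  show "finite (vertsP G)"
    using finite_verts game by (auto simp: stochastic_game_def intro: finite_subset)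
  fix u assume "u \<in> vertsP G"
  then have "u \<notin> verts1 G" "u \<notin> verts2 G" using game by (auto simp: stochastic_game_def)
  then have "next_prob G \<pi>1 \<pi>2 (h @ [u]) y = trans_prob G u y" for h y
    by (simp add: next_prob_def)
  then show "AE \<omega> in play_measure. u \<in> inf_verts \<omega> \<longrightarrow> post G u \<subseteq> inf_verts \<omega>"
    by (intro AE_inf_verts_post) (auto simp: post_def)
qed

text \<open>Measurability is what turns an almost sure statement into
  \<open>measure = 1\<close>.\<close>

lemma sets_reach_terminal: "reach_terminal G \<in> sets play_measure"
proof -
  have [measurable]: "Measurable.pred play_measure (\<lambda>\<omega>. 0 < trans_prob G (\<omega> k) (\<omega> (Suc k)))" for k
    by (rule measurable_edge) simp
  have [measurable]: "Measurable.pred play_measure (\<lambda>\<omega>. \<omega> k \<in> terminal G)" for k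
    by (rule measurable_compose[OF measurable_vertex]) simp
  have "reach_terminal G = {\<omega> \<in> space play_measure.
      (\<forall>k. 0 < trans_prob G (\<omega> k) (\<omega> (Suc k))) \<and> (\<exists>k. \<omega> k \<in> terminal G)}"
    by (auto simp: reach_terminal_def paths_def space_play_measure)
  also have "\<dots> \<in> sets play_measure" by measurable
  finally show ?thesis .
qed

lemma sets_fair_plays2: "fair_plays2 G \<in> sets play_measure"
proof -
  have [measurable]: "Measurable.pred play_measure (\<lambda>\<omega>. 0 < trans_prob G (\<omega> k) (\<omega> (Suc k)))" for k
    by (rule measurable_edge) simp
  have [measurable]: "Measurable.pred play_measure (\<lambda>\<omega>. u \<in> inf_verts \<omega>)" for u
    unfolding inf_verts_def INFM_nat mem_Collect_eq by measurable
  have [simp]: "finite (verts2 G)" "finite (post G u)" for u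
    using finite_verts game by (auto simp: stochastic_game_def post_def intro: finite_subset)
  have "fair_plays2 G = {\<omega> \<in> space play_measure.
      (\<forall>k. 0 < trans_prob G (\<omega> k) (\<omega> (Suc k))) \<and>
      (\<forall>u\<in>verts2 G. u \<in> inf_verts \<omega> \<longrightarrow> (\<forall>y\<in>post G u. y \<in> inf_verts \<omega>))}"
    by (auto simp: fair_plays2_def paths_def space_play_measure)
  also have "\<dots> \<in> sets play_measure" by measurable
  finally show ?thesis .
qed

end

section \<open>Traps\<close>

definition trap :: "'v game \<Rightarrow> 'v set \<Rightarrow> bool" where
  "trap G S \<longleftrightarrow> S \<subseteq> verts G \<and> S \<inter> terminal G = {} \<and>
     (\<forall>u\<in>S. if u \<in> verts1 G then post G u \<inter> S \<noteq> {} else post G u \<subseteq> S)"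

lemma inf_verts_nonempty:
  assumes "finite V" "\<And>k. \<omega> k \<in> V"
  shows "inf_verts \<omega> \<noteq> {}"
proof -
  have "finite (range \<omega>)" using assms by (auto intro: finite_subset)
  then obtain k where "infinite {l. \<omega> l = \<omega> k}"
    using pigeonhole_infinite[of UNIV \<omega>] by auto
  then show ?thesis by (auto simp: inf_verts_def frequently_cofinite)
qed

text \<open>By pigeonhole, one successor recurs among the infinitely many visits to
  \<open>u\<close>, and shifting time by one is injective. The witness \<open>k\<close> also shows
  that \<open>u\<close> occurs on the play.\<close>

lemma inf_verts_successor:
  assumes "finite V" "\<And>k. \<omega> k \<in> V" "u \<in> inf_verts \<omega>"
  shows "\<exists>k. \<omega> k = u \<and> \<omega> (Suc k) \<in> inf_verts \<omega>"
proof -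
  have "finite ((\<lambda>k. \<omega> (Suc k)) ` {k. \<omega> k = u})" using assms(1,2) by (auto intro: finite_subset)
  moreover have "infinite {k. \<omega> k = u}" using assms(3) by (simp add: inf_verts_def frequently_cofinite)
  ultimately obtain k where k: "\<omega> k = u" "infinite {l \<in> {k. \<omega> k = u}. \<omega> (Suc l) = \<omega> (Suc k)}"
    using pigeonhole_infinite[of "{k. \<omega> k = u}" "\<lambda>k. \<omega> (Suc k)"] by blast
  then have "infinite (Suc ` {l \<in> {k. \<omega> k = u}. \<omega> (Suc l) = \<omega> (Suc k)})"
    by (simp add: finite_image_iff)
  then have "infinite {l. \<omega> l = \<omega> (Suc k)}"
    by (rule contrapos_nn) (auto elim: finite_subset[rotated])
  with k show ?thesis by (auto simp: inf_verts_def frequently_cofinite)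
qed

section \<open>Traps characterise the failure of stopping\<close>

lemma stopping_if_no_trap:
  assumes G: "stochastic_game G" and no_trap: "\<And>S. trap G S \<Longrightarrow> S = {}"
  shows "stopping_under_fairness G"
  unfolding stopping_under_fairness_def
proof (intro allI impI)
  fix \<pi>1 \<pi>2 v
  assume s1: "strategy1 G \<pi>1" and fair: "fair_strategy2 G \<pi>2" and v: "v \<in> verts G"
  interpret play G \<pi>1 \<pi>2 v
    using G s1 fair v by unfold_locales (auto simp: fair_strategy2_def)
  have "AE \<omega> in play_measure. \<omega> \<in> fair_plays2 G"
    using fair s1 v by (intro play.AE_prob_1) (auto simp: fair_strategy2_def)
  then have "AE \<omega> in play_measure. \<omega> \<in> reach_terminal G"
    using AE_vertsP_post
  proof eventually_elim
    case (elim \<omega>)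
    then have path: "\<omega> \<in> paths G" by (simp add: fair_plays2_def)
    then have \<omega>: "\<omega> k \<in> verts G" "\<omega> (Suc k) \<in> post G (\<omega> k)" for k
      by (auto simp: paths_def post_def)
    have "\<exists>k. \<omega> k \<in> terminal G"
    proof (rule ccontr)
      assume "\<nexists>k. \<omega> k \<in> terminal G"
      moreover have occurs: "u \<in> range \<omega>" if "u \<in> inf_verts \<omega>" for u
        using inf_verts_successor[OF finite_verts \<omega>(1) that] by auto
      ultimately have "inf_verts \<omega> \<inter> terminal G = {}" and sub: "inf_verts \<omega> \<subseteq> verts G"
        using \<omega>(1) by auto
      moreover have "post G u \<inter> inf_verts \<omega> \<noteq> {}" if "u \<in> inf_verts \<omega>" for u
        using inf_verts_successor[OF finite_verts \<omega>(1) that] \<omega>(2) by blast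
      moreover have "post G u \<subseteq> inf_verts \<omega>" if "u \<in> inf_verts \<omega>" "u \<notin> verts1 G" for u
      proof -
        have "u \<in> verts2 G \<or> u \<in> vertsP G"
          using that sub G unfolding stochastic_game_def by blast
        then show ?thesis using elim that by (auto simp: fair_plays2_def)
      qed
      ultimately have "trap G (inf_verts \<omega>)" by (simp add: trap_def)
      then have "inf_verts \<omega> = {}" by (rule no_trap)
      then show False using inf_verts_nonempty[OF finite_verts \<omega>(1)] by simp
    qed
    with path show ?case by (simp add: reach_terminal_def)
  qed
  then show "measure play_measure (reach_terminal G) = 1"
    by (simp add: play.prob_eq_1 sets_reach_terminal)
qed

text \<open>Without a fair strategy stopping would hold vacuously. At every visit the uniform choice
  gives each successor the same positive probability, whatever the history and Player 1 do.\<close>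

lemma fair_strategy2_uniform:
  assumes G: "stochastic_game G"
  shows "fair_strategy2 G (\<lambda>h. pmf_of_set (post G (last h)))" (is "fair_strategy2 G ?\<pi>2")
  unfolding fair_strategy2_def
proof (intro conjI allI impI)
  have post: "finite (post G u)" "u \<in> verts G \<Longrightarrow> post G u \<noteq> {}" for u
    using G by (auto simp: stochastic_game_def post_def)
  have V2: "verts2 G \<subseteq> verts G" "verts1 G \<inter> verts2 G = {}"
    using G by (auto simp: stochastic_game_def)
  with post show s2: "strategy2 G ?\<pi>2"
    by (auto simp: strategy2_def set_pmf_of_set)
  fix \<pi>1 v assume s1: "strategy1 G \<pi>1" and v: "v \<in> verts G"
  interpret play G \<pi>1 ?\<pi>2 v
    using G s1 s2 v by unfold_locales
  have "AE \<omega> in play_measure. \<forall>u\<in>verts2 G. u \<in> inf_verts \<omega> \<longrightarrow> post G u \<subseteq> inf_verts \<omega>"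
  proof (rule AE_finite_allI)
    show "finite (verts2 G)" using V2 finite_verts by (auto intro: finite_subset)
    fix u assume u: "u \<in> verts2 G"
    show "AE \<omega> in play_measure. u \<in> inf_verts \<omega> \<longrightarrow> post G u \<subseteq> inf_verts \<omega>"
    proof (rule AE_inf_verts_post)
      fix y assume y: "y \<in> post G u"
      then have "next_prob G \<pi>1 ?\<pi>2 (h @ [u]) y = 1 / card (post G u)" for h
        using u V2 post[of u] by (auto simp: next_prob_def)
      moreover have "0 < 1 / real (card (post G u))"
        using y post(1) by (auto simp: card_gt_0_iff)
      ultimately show "\<exists>e>0. \<forall>h\<in>lists (verts G). e \<le> next_prob G \<pi>1 ?\<pi>2 (h @ [u]) y"
        by (metis order_refl)
    qed
  qed
  with AE_paths have "AE \<omega> in play_measure. \<omega> \<in> fair_plays2 G"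
    by eventually_elim (simp add: fair_plays2_def)
  then show "measure play_measure (fair_plays2 G) = 1"
    by (simp add: play.prob_eq_1 sets_fair_plays2)
qed

lemma trap_empty_if_stopping:
  assumes G: "stochastic_game G" and stop: "stopping_under_fairness G" and S: "trap G S"
  shows "S = {}"
proof (rule ccontr)
  assume "S \<noteq> {}"
  then obtain v where v: "v \<in> S" by blast
  with S have vG: "v \<in> verts G" by (auto simp: trap_def)
  \<comment> \<open>The first branch is a default: it keeps \<open>\<pi>1\<close> a legal strategy
    at vertices without a successor in \<open>S\<close>, and is never taken at a Player 1 vertex of
    the trap.\<close>
  define \<pi>1 :: "'a strategy" where
    "\<pi>1 h = pmf_of_set (if post G (last h) \<inter> S = {} then post G (last h) else post G (last h) \<inter> S)" for h
  let ?\<pi>2 = "\<lambda>h. pmf_of_set (post G (last h))"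
  have post: "finite (post G u)" "u \<in> verts G \<Longrightarrow> post G u \<noteq> {}" for u
    using G by (auto simp: stochastic_game_def post_def)
  have "verts1 G \<subseteq> verts G" using G by (auto simp: stochastic_game_def)
  with post have s1: "strategy1 G \<pi>1"
    by (auto simp: strategy1_def \<pi>1_def set_pmf_of_set)
  note fair = fair_strategy2_uniform[OF G]
  interpret play G \<pi>1 ?\<pi>2 v
    using G s1 fair vG by unfold_locales (auto simp: fair_strategy2_def)
  have "AE \<omega> in play_measure. \<omega> \<in> reach_terminal G"
    using stop s1 fair vG by (intro play.AE_prob_1) (auto simp: stopping_under_fairness_def)
  then have "AE \<omega> in play_measure. False"
    using AE_start AE_paths AE_next_prob_pos
  proof eventually_elim
    case (elim \<omega>)
    have "\<omega> k \<in> S" for k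
    proof (induction k)
      case 0
      then show ?case using elim v by simp
    next
      case (Suc k)
      have step: "\<omega> (Suc k) \<in> post G (\<omega> k)" using elim(3) by (auto simp: paths_def post_def)
      show ?case
      proof (cases "\<omega> k \<in> verts1 G")
        case True
        then have "post G (\<omega> k) \<inter> S \<noteq> {}" using S Suc by (auto simp: trap_def)
        moreover have "0 < pmf (\<pi>1 (map \<omega> [0..<Suc k])) (\<omega> (Suc k))"
          using elim(4)[rule_format, of k] True by (simp add: next_prob_def)
        ultimately show ?thesis
          using post(1) by (auto simp: \<pi>1_def pmf_positive_iff set_pmf_of_set)
      next
        case False
        then have "post G (\<omega> k) \<subseteq> S" using S Suc unfolding trap_def by metis
        with step show ?thesis by blast
      qed
    qed
    moreover obtain k where "\<omega> k \<in> terminal G" using elim(1) by (auto simp: reach_terminal_def)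
    ultimately show False using S by (auto simp: trap_def)
  qed
  then show False by simp
qed

lemma stopping_iff_no_trap:
  "stochastic_game G \<Longrightarrow> stopping_under_fairness G \<longleftrightarrow> (\<forall>S. trap G S \<longrightarrow> S = {})"
  using stopping_if_no_trap trap_empty_if_stopping by blast

section \<open>Computing the largest trap\<close>

context
  fixes n :: nat and E :: "nat \<Rightarrow> nat \<Rightarrow> bool" and p1 :: "nat \<Rightarrow> bool"
begin

text \<open>The vertices are numbered from 0, \<open>E\<close> is the successor relation and \<open>p1\<close> singles out the
  vertices of Player 1. The first disjunct of \<open>doomed\<close> describes the terminal vertices.\<close>

definition doomed :: "nat set \<Rightarrow> nat \<Rightarrow> bool" where
  "doomed D i \<longleftrightarrow> \<not> (\<exists>j<n. E i j \<and> j \<noteq> i) \<or>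
     (if p1 i then \<not> (\<exists>j<n. E i j \<and> j \<notin> D) else (\<exists>j<n. E i j \<and> j \<in> D))"

text \<open>Vertex \<open>i\<close> is tested against the flags already changed earlier in the same
  sweep, as on a machine with a single array of flags.\<close>

primrec sweep :: "nat set \<Rightarrow> nat \<Rightarrow> nat set" where
  "sweep D 0 = D"
| "sweep D (Suc i) = (if doomed (sweep D i) i then insert i (sweep D i) else sweep D i)"

definition rounds :: "nat \<Rightarrow> nat set" where
  "rounds m = ((\<lambda>D. sweep D n) ^^ m) {}"

lemma rounds_0: "rounds 0 = {}" and rounds_Suc: "rounds (Suc m) = sweep (rounds m) n"
  by (simp_all add: rounds_def)

lemma doomed_mono: "D \<subseteq> D' \<Longrightarrow> doomed D i \<Longrightarrow> doomed D' i"
  by (auto simp: doomed_def split: if_splits)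

lemma sweep_mono: "k \<le> l \<Longrightarrow> sweep D k \<subseteq> sweep D l"
  by (induction rule: dec_induct) auto

lemma sweep_subset: "sweep D k \<subseteq> D \<union> {..<k}"
  by (induction k) auto

lemma subset_sweep: "D \<subseteq> sweep D k"
  using sweep_mono[of 0 k D] by simp

lemma rounds_subset: "rounds m \<subseteq> {..<n}"
  by (induction m) (use sweep_subset in \<open>force simp: rounds_0 rounds_Suc\<close>)+

text \<open>Sweeps only add vertices, so if a full sweep changes nothing, every vertex was tested
  against \<open>D\<close> itself.\<close>

lemma stable_doomed:
  assumes stable: "sweep D n = D" and i: "i < n" and doomed: "doomed D i"
  shows "i \<in> D"
proof -
  have "sweep D k = D" if "k \<le> n" for k
    using sweep_mono[OF that, of D] stable subset_sweep[of D k] by simp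
  from this[of i] this[of "Suc i"] i have "sweep D i = D" "sweep D (Suc i) = D" by simp_all
  with doomed show ?thesis by (auto split: if_splits)
qed

text \<open>Either some round changed nothing, and then no later one does, or each of the
  \<open>n\<close> rounds added a vertex and all of \<open>{..<n}\<close> is used up.\<close>

lemma rounds_stable: "sweep (rounds n) n = rounds n"
proof -
  have fin: "finite (rounds m)" for m using rounds_subset by (rule finite_subset) simp
  have "m \<le> card (rounds m) \<or> sweep (rounds m) n = rounds m" for m
  proof (induction m)
    case (Suc m)
    show ?case
    proof (cases "sweep (rounds m) n = rounds m")
      case False
      then have "rounds m \<subset> rounds (Suc m)" using subset_sweep by (auto simp: rounds_Suc)
      then have "card (rounds m) < card (rounds (Suc m))" using fin by (intro psubset_card_mono)
      with Suc False show ?thesis by simp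
    qed (simp add: rounds_Suc)
  qed simp
  then consider "n \<le> card (rounds n)" | "sweep (rounds n) n = rounds n" by blast
  then show ?thesis
  proof cases
    case 1
    then have "rounds n = {..<n}" using rounds_subset by (intro card_seteq) auto
    then show ?thesis using subset_sweep[of "rounds n" n] sweep_subset[of "rounds n" n] by auto
  qed
qed

text \<open>As long as the dead set misses \<open>S\<close> it lies in \<open>- S\<close>, and by
  monotonicity it dooms no more than \<open>- S\<close> does. Hence the in-place updates are
  harmless.\<close>

lemma rounds_disjoint:
  assumes "\<And>i. i \<in> S \<Longrightarrow> \<not> doomed (- S) i"
  shows "rounds m \<inter> S = {}"
proof (induction m)
  case (Suc m)
  have "sweep (rounds m) k \<inter> S = {}" for k
  proof (induction k)
    case (Suc k)
    then show ?case using assms doomed_mono[of "sweep (rounds m) k" "- S" k] by auto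
  qed (use Suc in simp)
  then show ?case by (simp add: rounds_Suc)
qed (simp add: rounds_0)

lemma rounds_complete_iff:
  "{..<n} \<subseteq> rounds n \<longleftrightarrow> (\<forall>S. S \<subseteq> {..<n} \<longrightarrow> (\<forall>i\<in>S. \<not> doomed (- S) i) \<longrightarrow> S = {})"
proof
  assume "{..<n} \<subseteq> rounds n"
  then show "\<forall>S. S \<subseteq> {..<n} \<longrightarrow> (\<forall>i\<in>S. \<not> doomed (- S) i) \<longrightarrow> S = {}"
    using rounds_disjoint[of _ n] by blast
next
  assume none: "\<forall>S. S \<subseteq> {..<n} \<longrightarrow> (\<forall>i\<in>S. \<not> doomed (- S) i) \<longrightarrow> S = {}"
  let ?S = "{..<n} - rounds n"
  have "\<not> doomed (- ?S) i" if "i \<in> ?S" for i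
  proof
    assume "doomed (- ?S) i"
    \<comment> \<open>\<open>- ?S\<close> exceeds \<open>rounds n\<close> only by numbers from
      \<open>n\<close> on, which \<open>doomed\<close> never inspects.\<close>
    then have "doomed (rounds n) i" by (auto simp: doomed_def split: if_splits)
    with that show False using stable_doomed[OF rounds_stable] by auto
  qed
  then have "?S = {}" using none[rule_format, of ?S] by simp
  then show "{..<n} \<subseteq> rounds n" by blast
qed

end

section \<open>The machine\<close>

text \<open>A total-correctness judgement with a time budget; \<open>T\<close> is only an upper
  bound, so that branches of different lengths can share it.\<close>

definition reaches :: "ram \<Rightarrow> nat list \<Rightarrow> nat \<Rightarrow> ram_config \<Rightarrow> (nat \<Rightarrow> (nat \<Rightarrow> nat) \<Rightarrow> bool) \<Rightarrow> bool" where
  "reaches P w T c Q \<longleftrightarrow> (\<exists>t\<le>T. \<exists>pc r. (ram_step P w ^^ t) c = (pc, r) \<and> Q pc r)"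

lemma reachesI: "(ram_step P w ^^ t) c = (pc, r) \<Longrightarrow> Q pc r \<Longrightarrow> t \<le> T \<Longrightarrow> reaches P w T c Q"
  unfolding reaches_def by (intro exI conjI)

lemma reachesE:
  assumes "reaches P w T c Q"
  obtains t pc r where "t \<le> T" "(ram_step P w ^^ t) c = (pc, r)" "Q pc r"
  using assms unfolding reaches_def by (elim exE conjE)

lemma reaches_done: "Q pc r \<Longrightarrow> reaches P w T (pc, r) Q"
  by (rule reachesI[where t=0 and Q=Q]) simp_all

lemma reaches_step:
  assumes "0 < T" "pc < length P" "P ! pc = I" "reaches P w (T - 1) (exec_instr w I (pc, r)) Q"
  shows "reaches P w T (pc, r) Q"
proof -
  obtain t pc' r' where t: "t \<le> T - 1"
    and run: "(ram_step P w ^^ t) (exec_instr w I (pc, r)) = (pc', r')" and Q: "Q pc' r'"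
    using assms(4) by (rule reachesE)
  have "ram_step P w (pc, r) = exec_instr w I (pc, r)"
    using assms(2,3) by (simp add: ram_step_def ram_halted_def)
  with run have "(ram_step P w ^^ Suc t) (pc, r) = (pc', r')"
    by (simp only: funpow_Suc_right o_apply)
  then show ?thesis
    using Q by (rule reachesI[where Q=Q]) (use t assms(1) in simp)
qed

lemma reaches_mono: "reaches P w T c Q \<Longrightarrow> T \<le> T' \<Longrightarrow> reaches P w T' c Q"
  by (erule reachesE) (rule reachesI[where Q=Q], assumption+, simp)

lemma reaches_trans:
  assumes "reaches P w T1 c (\<lambda>pc r. pc = l \<and> A r)" "\<And>r. A r \<Longrightarrow> reaches P w T2 (l, r) Q"
    and "T1 + T2 \<le> T"
  shows "reaches P w T c Q"
proof -
  obtain t1 r where t1: "t1 \<le> T1" "(ram_step P w ^^ t1) c = (l, r)" and A: "A r"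
    using assms(1) by (elim reachesE) auto
  from assms(2)[OF A] obtain t2 pc r' where t2: "t2 \<le> T2"
    and run: "(ram_step P w ^^ t2) (l, r) = (pc, r')" and Q: "Q pc r'"
    by (rule reachesE)
  from t1(2) run have "(ram_step P w ^^ (t2 + t1)) c = (pc, r')"
    by (simp only: funpow_add o_apply)
  then show ?thesis
    using Q by (rule reachesI[where Q=Q]) (use t1(1) t2 assms(3) in simp)
qed

text \<open>Register 2 holds the number of vertices, registers 3, 4 and 5 the loop counters, register 6 the
  position of the current numerator in the input; registers 7, 8 and 9 record whether the current
  vertex has a successor that is alive, dead, or different from itself. The flag of vertex
  \<open>k\<close> is register \<open>13 + k\<close>; it is 1 when the vertex is dead.\<close>

definition trap_prog :: ram where
  "trap_prog = [
     Const 1 1,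
     Const 12 13,
     Read 2 0,
     Move 3 2,
     JumpZero 3 48,        \<comment> \<open>4: next round\<close>
     Const 4 0,
     Add 6 2 1,
     Sub 10 2 4,           \<comment> \<open>7: next vertex\<close>
     JumpZero 10 46,
     Const 7 0,
     Const 8 0,
     Const 9 0,
     Const 5 0,
     Sub 10 2 5,           \<comment> \<open>13: next potential successor\<close>
     JumpZero 10 32,
     Read 10 6,
     JumpZero 10 28,
     Add 10 12 5,
     Load 11 10,
     JumpZero 11 22,
     Const 8 1,
     Jump 23,
     Const 7 1,            \<comment> \<open>22\<close>
     Sub 10 4 5,           \<comment> \<open>23\<close>
     Sub 11 5 4,
     Add 10 10 11,
     JumpZero 10 28,
     Const 9 1,
     Add 6 6 1,            \<comment> \<open>28\<close>
     Add 6 6 1,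
     Add 5 5 1,
     Jump 13,
     JumpZero 9 42,        \<comment> \<open>32: all successors seen\<close>
     Add 10 4 1,
     Read 10 10,
     JumpZero 10 38,
     Sub 10 10 1,
     JumpZero 10 40,
     JumpZero 8 44,        \<comment> \<open>38: not a vertex of Player 1\<close>
     Jump 42,
     JumpZero 7 42,        \<comment> \<open>40: vertex of Player 1\<close>
     Jump 44,
     Add 10 12 4,          \<comment> \<open>42: the vertex dies\<close>
     Store 10 1,
     Add 4 4 1,            \<comment> \<open>44\<close>
     Jump 7,
     Sub 3 3 1,            \<comment> \<open>46\<close>
     Jump 4,
     Const 4 0,            \<comment> \<open>48: is every vertex dead?\<close>
     Sub 10 2 4,           \<comment> \<open>49\<close>
     JumpZero 10 56,
     Add 10 12 4,
     Load 11 10,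
     JumpZero 11 57,
     Add 4 4 1,
     Jump 49,
     Const 0 1]            \<comment> \<open>56\<close>"

lemma length_trap_prog [simp]: "length trap_prog = 57"
  by (simp add: trap_prog_def)

section \<open>Loop invariants and running times\<close>

context
  fixes w :: "nat list"
begin

definition inp :: "nat \<Rightarrow> nat" where
  "inp k = (if k < length w then w ! k else 0)"

abbreviation "nverts \<equiv> inp 0"

text \<open>The count and the owners occupy the first \<open>nverts + 1\<close> entries; the factor
  2 skips the denominators.\<close>

definition edge :: "nat \<Rightarrow> nat \<Rightarrow> bool" where
  "edge i j \<longleftrightarrow> inp (nverts + 1 + 2 * (i * nverts + j)) \<noteq> 0"

definition owned1 :: "nat \<Rightarrow> bool" where
  "owned1 i \<longleftrightarrow> inp (i + 1) = 1"

text \<open>Register 1 is the constant 1, register 12 the base address of the flags, and register 0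
  is the default answer "no". \<open>Suc 0\<close> is the simplifier's normal form of 1.\<close>

definition flags :: "nat set \<Rightarrow> (nat \<Rightarrow> nat) \<Rightarrow> bool" where
  "flags D r \<longleftrightarrow> r 0 = 0 \<and> r (Suc 0) = 1 \<and> r 2 = nverts \<and> r 12 = 13 \<and>
     (\<forall>k. r (13 + k) = of_bool (k \<in> D))"

text \<open>Register 6 moves through the matrix in step with the counters, as the machine cannot
  multiply to compute an address.\<close>

definition at_vertex :: "nat set \<Rightarrow> nat \<Rightarrow> nat \<Rightarrow> (nat \<Rightarrow> nat) \<Rightarrow> bool" where
  "at_vertex D m i r \<longleftrightarrow> flags D r \<and> r 3 = m \<and> r 4 = i \<and> r 6 = nverts + 1 + 2 * (i * nverts)"

definition at_edge :: "nat set \<Rightarrow> nat \<Rightarrow> nat \<Rightarrow> nat \<Rightarrow> (nat \<Rightarrow> nat) \<Rightarrow> bool" where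
  "at_edge D m i j r \<longleftrightarrow> flags D r \<and> r 3 = m \<and> r 4 = i \<and> r 5 = j \<and>
     r 6 = nverts + 1 + 2 * (i * nverts + j) \<and>
     r 7 = of_bool (\<exists>j'<j. edge i j' \<and> j' \<notin> D) \<and>
     r 8 = of_bool (\<exists>j'<j. edge i j' \<and> j' \<in> D) \<and>
     r 9 = of_bool (\<exists>j'<j. edge i j' \<and> j' \<noteq> i)"

lemma exec_Read [simp]: "exec_instr w (Read d a) (pc, r) = (Suc pc, r(d := inp (r a)))"
  by (simp add: inp_def)

declare exec_instr.simps(7) [simp del]

lemma ex_less_Suc: "(\<exists>j'<Suc j. A j') \<longleftrightarrow> (\<exists>j'<j. A j') \<or> A j" for A :: "nat \<Rightarrow> bool"
  by (auto simp: less_Suc_eq)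

text \<open>Repeated use is symbolic execution. It ends when the budget reaches 0, so each numeral
  below is the exact length of a path, relaxed afterwards by \<open>reaches_mono\<close>.\<close>

lemmas prog_step = reaches_step[where P=trap_prog]

lemma edge_step:
  assumes inv: "at_edge D m i j r" and j: "j < nverts"
  shows "reaches trap_prog w 18 (13, r) (\<lambda>pc r'. pc = 13 \<and> at_edge D m i (Suc j) r')"
proof -
  \<comment> \<open>A zero test on a truncated difference simplifies to
    \<open>nverts \<le> j\<close>, so the hypothesis is supplied as its negation.\<close>
  note inv = inv[unfolded at_edge_def flags_def] j[unfolded not_le[symmetric]]
  have succ: "0 < inp (r 6)" if "edge i j"
    using that inv by (simp add: edge_def)
  have nsucc: "inp (r 6) = 0" if "\<not> edge i j"
    using that inv by (simp add: edge_def)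
  note inv' = at_edge_def flags_def inv ex_less_Suc
  \<comment> \<open>One case per path through the loop body; the longest, an edge to a dead vertex
    other than \<open>i\<close>, takes 18 steps.\<close>
  consider "\<not> edge i j" | "edge i j" "j \<in> D" "i \<noteq> j" | "edge i j" "j \<in> D" "i = j"
    | "edge i j" "j \<notin> D" "i \<noteq> j" | "edge i j" "j \<notin> D" "i = j" by blast
  then show ?thesis
  proof cases
    case 1
    from nsucc[OF 1] have "reaches trap_prog w 8 (13, r) (\<lambda>pc r'. pc = 13 \<and> at_edge D m i (Suc j) r')"
      by - ((rule prog_step, simp, simp, simp add: trap_prog_def, simp add: inv)+,
          rule reaches_done, simp add: inv' 1)
    then show ?thesis by (rule reaches_mono) simp
  next
    case 2
    \<comment> \<open>The machine compares \<open>i\<close> and \<open>j\<close> by adding both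
      truncated differences; this conjunction is what remains of its zero test.\<close>
    then have ij: "(i \<le> j \<and> j \<le> i) = False" by auto
    from succ[OF 2(1)] show ?thesis
      by - ((rule prog_step, simp, simp, simp add: trap_prog_def, simp add: inv 2 ij)+,
          rule reaches_done, simp add: inv' 2 2(3)[symmetric])
  next
    case 3
    from succ[OF 3(1)] have "reaches trap_prog w 17 (13, r) (\<lambda>pc r'. pc = 13 \<and> at_edge D m i (Suc j) r')"
      by - ((rule prog_step, simp, simp, simp add: trap_prog_def, simp add: inv 3(2,3))+,
          rule reaches_done, use 3 in \<open>simp add: inv'\<close>)
    then show ?thesis by (rule reaches_mono) simp
  next
    case 4
    then have ij: "(i \<le> j \<and> j \<le> i) = False" by auto
    from succ[OF 4(1)] have "reaches trap_prog w 17 (13, r) (\<lambda>pc r'. pc = 13 \<and> at_edge D m i (Suc j) r')"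
      by - ((rule prog_step, simp, simp, simp add: trap_prog_def, simp add: inv 4 ij)+,
          rule reaches_done, simp add: inv' 4 4(3)[symmetric])
    then show ?thesis by (rule reaches_mono) simp
  next
    case 5
    from succ[OF 5(1)] have "reaches trap_prog w 16 (13, r) (\<lambda>pc r'. pc = 13 \<and> at_edge D m i (Suc j) r')"
      by - ((rule prog_step, simp, simp, simp add: trap_prog_def, simp add: inv 5(2,3))+,
          rule reaches_done, use 5 in \<open>simp add: inv'\<close>)
    then show ?thesis by (rule reaches_mono) simp
  qed
qed

lemma edge_loop:
  "at_edge D m i j r \<Longrightarrow> j \<le> nverts \<Longrightarrow>
    reaches trap_prog w (18 * (nverts - j) + 2) (13, r) (\<lambda>pc r'. pc = 32 \<and> at_edge D m i nverts r')"
proof (induction "nverts - j" arbitrary: j r)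
  case 0
  note inv = 0(2)[unfolded at_edge_def flags_def]
  have "j = nverts" using 0 by simp
  with 0 have "reaches trap_prog w 2 (13, r) (\<lambda>pc r'. pc = 32 \<and> at_edge D m i nverts r')"
    by - ((rule prog_step, simp, simp, simp add: trap_prog_def, simp add: inv)+,
        rule reaches_done, simp add: at_edge_def flags_def)
  then show ?case by (rule reaches_mono) simp
next
  case (Suc d)
  from Suc(2) have "j < nverts" and d: "nverts - j = Suc d" "nverts - Suc j = d" by linarith+
  have "reaches trap_prog w (18 * (nverts - Suc j) + 2) (13, r')
      (\<lambda>pc r'. pc = 32 \<and> at_edge D m i nverts r')" if "at_edge D m i (Suc j) r'" for r'
    using that Suc(2) by (intro Suc(1)) auto
  with edge_step[OF Suc(3) \<open>j < nverts\<close>] show ?case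
    by (rule reaches_trans) (simp_all add: d)
qed

lemma vertex_enter:
  assumes inv: "at_vertex D m i r" and i: "i < nverts"
  shows "reaches trap_prog w 6 (7, r) (\<lambda>pc r'. pc = 13 \<and> at_edge D m i 0 r')"
proof -
  note inv = inv[unfolded at_vertex_def flags_def] i[unfolded not_le[symmetric]]
  show ?thesis
    by - ((rule prog_step, simp, simp, simp add: trap_prog_def, simp add: inv)+,
        rule reaches_done, simp add: at_edge_def flags_def inv)
qed

lemma vertex_decide:
  assumes inv: "at_edge D m i nverts r"
  shows "reaches trap_prog w 12 (32, r) (\<lambda>pc r'. pc = 7 \<and>
    at_vertex (if doomed nverts edge owned1 D i then insert i D else D) m (Suc i) r')"
proof -
  define A B C where "A \<longleftrightarrow> (\<exists>j<nverts. edge i j \<and> j \<noteq> i)" and "B \<longleftrightarrow> (\<exists>j<nverts. edge i j \<and> j \<notin> D)"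
    and "C \<longleftrightarrow> (\<exists>j<nverts. edge i j \<and> j \<in> D)"
  note inv = inv[unfolded at_edge_def flags_def, folded A_def B_def C_def]
  have doomed: "doomed nverts edge owned1 D i \<longleftrightarrow> \<not> A \<or> (if inp (Suc i) = 1 then \<not> B else C)"
    by (simp add: doomed_def owned1_def A_def B_def C_def)
  define D' where "D' = (if doomed nverts edge owned1 D i then insert i D else D)"
  have mem: "k \<in> D' \<longleftrightarrow> k = i \<and> (\<not> A \<or> (if inp (Suc i) = 1 then \<not> B else C)) \<or> k \<in> D" for k
    by (simp add: D'_def doomed)
  note inv' = inv mem at_vertex_def flags_def
  let ?Q = "\<lambda>pc r'. pc = 7 \<and> at_vertex D' m (Suc i) r'"
  \<comment> \<open>Tag 1 is recognised by a zero test before and after subtracting 1; tag 0 and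
    tags above 1 share a branch but reach it by different paths.\<close>
  consider "\<not> A" | "A" "inp (Suc i) = 0" "\<not> C" | "A" "inp (Suc i) = 0" "C"
    | "A" "inp (Suc i) = 1" "\<not> B" | "A" "inp (Suc i) = 1" "B"
    | "A" "inp (Suc i) > 1" "\<not> C" | "A" "inp (Suc i) > 1" "C"
    by linarith
  then have "reaches trap_prog w 12 (32, r) ?Q"
  proof cases
    case 1
    then have "reaches trap_prog w 5 (32, r) ?Q"
      by - ((rule prog_step, simp, simp, simp add: trap_prog_def, simp add: inv)+,
          rule reaches_done, auto simp: inv')
    then show ?thesis by (rule reaches_mono) simp
  next
    case 2
    then have "reaches trap_prog w 7 (32, r) ?Q"
      by - ((rule prog_step, simp, simp, simp add: trap_prog_def, simp add: inv)+,
          rule reaches_done, auto simp: inv')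
    then show ?thesis by (rule reaches_mono) simp
  next
    case 3
    then have "reaches trap_prog w 10 (32, r) ?Q"
      by - ((rule prog_step, simp, simp, simp add: trap_prog_def, simp add: inv)+,
          rule reaches_done, auto simp: inv')
    then show ?thesis by (rule reaches_mono) simp
  next
    case 4
    then have "reaches trap_prog w 11 (32, r) ?Q"
      by - ((rule prog_step, simp, simp, simp add: trap_prog_def, simp add: inv)+,
          rule reaches_done, auto simp: inv')
    then show ?thesis by (rule reaches_mono) simp
  next
    case 5
    then have "reaches trap_prog w 10 (32, r) ?Q"
      by - ((rule prog_step, simp, simp, simp add: trap_prog_def, simp add: inv)+,
          rule reaches_done, auto simp: inv')
    then show ?thesis by (rule reaches_mono) simp
  next
    case 6
    then have "\<not> inp (Suc i) \<le> Suc 0" by simp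
    with 6 have "reaches trap_prog w 9 (32, r) ?Q"
      by - ((rule prog_step, simp, simp, simp add: trap_prog_def, simp add: inv)+,
          rule reaches_done, auto simp: inv')
    then show ?thesis by (rule reaches_mono) simp
  next
    case 7
    then have "\<not> inp (Suc i) \<le> Suc 0" by simp
    with 7 show ?thesis
      by - ((rule prog_step, simp, simp, simp add: trap_prog_def, simp add: inv)+,
          rule reaches_done, auto simp: inv')
  qed
  then show ?thesis by (simp only: D'_def)
qed

text \<open>20 = 6 + 2 + 12: entering, leaving the edge loop, deciding.\<close>

lemma vertex_step:
  assumes "at_vertex D m i r" "i < nverts"
  shows "reaches trap_prog w (18 * nverts + 20) (7, r) (\<lambda>pc r'. pc = 7 \<and>
    at_vertex (if doomed nverts edge owned1 D i then insert i D else D) m (Suc i) r')"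
    (is "reaches _ _ _ _ ?Q")
proof -
  have "reaches trap_prog w (18 * nverts + 14) (13, r') ?Q" if "at_edge D m i 0 r'" for r'
    by (rule reaches_trans[OF edge_loop[OF that] vertex_decide]) simp_all
  then show ?thesis
    by (rule reaches_trans[OF vertex_enter[OF assms]]) simp_all
qed

lemma vertex_loop:
  "at_vertex (sweep nverts edge owned1 D i) m i r \<Longrightarrow> i \<le> nverts \<Longrightarrow>
    reaches trap_prog w ((18 * nverts + 20) * (nverts - i) + 2) (7, r)
      (\<lambda>pc r'. pc = 46 \<and> at_vertex (sweep nverts edge owned1 D nverts) m nverts r')"
proof (induction "nverts - i" arbitrary: i r)
  case 0
  note inv = 0(2)[unfolded at_vertex_def flags_def]
  have "i = nverts" using 0 by simp
  with 0 have "reaches trap_prog w 2 (7, r)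
      (\<lambda>pc r'. pc = 46 \<and> at_vertex (sweep nverts edge owned1 D nverts) m nverts r')"
    by - ((rule prog_step, simp, simp, simp add: trap_prog_def, simp add: inv)+,
        rule reaches_done, simp add: at_vertex_def flags_def)
  then show ?case by (rule reaches_mono) simp
next
  case (Suc d)
  from Suc(2) have "i < nverts" and d: "nverts - i = Suc d" "nverts - Suc i = d" by linarith+
  have tail: "reaches trap_prog w ((18 * nverts + 20) * (nverts - Suc i) + 2) (7, r')
      (\<lambda>pc r'. pc = 46 \<and> at_vertex (sweep nverts edge owned1 D nverts) m nverts r')"
    if "at_vertex (sweep nverts edge owned1 D (Suc i)) m (Suc i) r'" for r'
    using that Suc(2) by (intro Suc(1)) auto
  show ?case
    using vertex_step[OF Suc(3) \<open>i < nverts\<close>] by (rule reaches_trans[OF _ tail]) (simp_all add: d)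
qed

text \<open>7 = 3 + 2 + 2: entering, leaving the vertex loop, decrementing the round counter and
  jumping back.\<close>

lemma round_step:
  assumes inv: "flags D r" and m: "r 3 = Suc m"
  shows "reaches trap_prog w ((18 * nverts + 20) * nverts + 7) (4, r)
    (\<lambda>pc r'. pc = 4 \<and> flags (sweep nverts edge owned1 D nverts) r' \<and> r' 3 = m)" (is "reaches _ _ _ _ ?Q")
proof -
  note inv = inv[unfolded flags_def]
  have enter: "reaches trap_prog w 3 (4, r) (\<lambda>pc r'. pc = 7 \<and> at_vertex D (Suc m) 0 r')"
    by - ((rule prog_step, simp, simp, simp add: trap_prog_def, simp add: inv m)+,
        rule reaches_done, simp add: at_vertex_def flags_def inv m)
  have exit: "reaches trap_prog w 2 (46, r') ?Q"
    if "at_vertex (sweep nverts edge owned1 D nverts) (Suc m) nverts r'" for r'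
  proof -
    note inv = that[unfolded at_vertex_def flags_def]
    show ?thesis
      by - ((rule prog_step, simp, simp, simp add: trap_prog_def, simp add: inv)+,
          rule reaches_done, simp add: flags_def inv)
  qed
  have "reaches trap_prog w ((18 * nverts + 20) * nverts + 4) (7, r') ?Q" if "at_vertex D (Suc m) 0 r'" for r'
    using that by (intro reaches_trans[OF vertex_loop[of D 0] exit]) simp_all
  then show ?thesis
    by (rule reaches_trans[OF enter]) simp_all
qed

lemma round_loop:
  "flags (rounds nverts edge owned1 k) r \<Longrightarrow> r 3 = m \<Longrightarrow>
    reaches trap_prog w (m * ((18 * nverts + 20) * nverts + 7) + 1) (4, r)
      (\<lambda>pc r'. pc = 48 \<and> flags (rounds nverts edge owned1 (k + m)) r')"
proof (induction m arbitrary: k r)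
  case 0
  then have "reaches trap_prog w 1 (4, r) (\<lambda>pc r'. pc = 48 \<and> flags (rounds nverts edge owned1 (k + 0)) r')"
    by - ((rule prog_step, simp, simp, simp add: trap_prog_def, simp)+,   rule reaches_done, simp)
  then show ?case by simp
next
  case (Suc m)
  have tail: "reaches trap_prog w (m * ((18 * nverts + 20) * nverts + 7) + 1) (4, r')
      (\<lambda>pc r'. pc = 48 \<and> flags (rounds nverts edge owned1 (k + Suc m)) r')"
    if "flags (sweep nverts edge owned1 (rounds nverts edge owned1 k) nverts) r' \<and> r' 3 = m" for r'
    using Suc(1)[of "Suc k" r'] that by (simp add: rounds_Suc)
  show ?case
    by (rule reaches_trans[OF round_step[OF Suc(2,3)] tail]) simp_all
qed

text \<open>A live vertex makes the machine jump past the final assignment, leaving 0 in register 0;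
  only a loop that runs out of vertices executes it.\<close>

lemma check_loop:
  "flags D r \<Longrightarrow> r 4 = i \<Longrightarrow> i \<le> nverts \<Longrightarrow> {..<i} \<subseteq> D \<Longrightarrow>
    reaches trap_prog w (7 * (nverts - i) + 5) (49, r)
      (\<lambda>pc r'. pc = 57 \<and> r' 0 = of_bool ({..<nverts} \<subseteq> D))"
proof (induction "nverts - i" arbitrary: i r)
  case 0
  note inv = 0(2)[unfolded flags_def] 0(3)
  have "i = nverts" using 0 by simp
  with 0 have "reaches trap_prog w 3 (49, r) (\<lambda>pc r'. pc = 57 \<and> r' 0 = of_bool ({..<nverts} \<subseteq> D))"
    by - ((rule prog_step, simp, simp, simp add: trap_prog_def, simp add: inv)+,
        rule reaches_done, simp)
  then show ?case by (rule reaches_mono) simp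
next
  case (Suc d)
  note inv = Suc(3)[unfolded flags_def] Suc(4)
  have i: "i < nverts" "\<not> nverts \<le> i" using Suc(2) by simp_all
  show ?case
  proof (cases "i \<in> D")
    case True
    then have first: "reaches trap_prog w 7 (49, r) (\<lambda>pc r'. pc = 49 \<and> flags D r' \<and> r' 4 = Suc i)"
      by - ((rule prog_step, simp, simp, simp add: trap_prog_def, simp add: inv i)+,
          rule reaches_done, simp add: flags_def inv)
    have tail: "reaches trap_prog w (7 * (nverts - Suc i) + 5) (49, r')
        (\<lambda>pc r'. pc = 57 \<and> r' 0 = of_bool ({..<nverts} \<subseteq> D))" if "flags D r' \<and> r' 4 = Suc i" for r'
    proof (rule Suc(1))
      show "d = nverts - Suc i" using Suc(2) by simp
      show "{..<Suc i} \<subseteq> D" using True Suc(6) by (auto simp: less_Suc_eq)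
    qed (use that i in auto)
    have "nverts - i = Suc (nverts - Suc i)" using i(1) by simp
    then show ?thesis
      by (intro reaches_trans[OF first tail]) simp_all
  next
    case False
    then have "\<not> {..<nverts} \<subseteq> D" using i(1) by (meson lessThan_iff subsetD)
    with False have "reaches trap_prog w 5 (49, r) (\<lambda>pc r'. pc = 57 \<and> r' 0 = of_bool ({..<nverts} \<subseteq> D))"
      by - ((rule prog_step, simp, simp, simp add: trap_prog_def, simp add: inv i)+,
          rule reaches_done, simp add: inv)
    then show ?thesis by (rule reaches_mono) simp
  qed
qed

lemma trap_prog_reaches:
  "reaches trap_prog w (nverts * ((18 * nverts + 20) * nverts + 7) + 7 * nverts + 11) (0, \<lambda>_. 0)
    (\<lambda>pc r. pc = 57 \<and> r 0 = of_bool ({..<nverts} \<subseteq> rounds nverts edge owned1 nverts))" (is "reaches _ _ _ _ ?Q")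
proof -
  have init: "reaches trap_prog w 4 (0, \<lambda>_. 0)
      (\<lambda>pc r. pc = 4 \<and> flags (rounds nverts edge owned1 0) r \<and> r 3 = nverts)"
    by - ((rule prog_step, simp, simp, simp add: trap_prog_def, simp)+,
        rule reaches_done, simp add: flags_def rounds_0)
  have check: "reaches trap_prog w (7 * nverts + 5) (49, r) ?Q"
    if "flags (rounds nverts edge owned1 nverts) r \<and> r 4 = 0" for r
    using check_loop[of "rounds nverts edge owned1 nverts" r 0] that by simp
  have final: "reaches trap_prog w (7 * nverts + 6) (48, r) ?Q"
    if inv: "flags (rounds nverts edge owned1 (0 + nverts)) r" for r
  proof (rule reaches_trans[OF _ check])
    note inv = inv[unfolded flags_def]
    show "reaches trap_prog w 1 (48, r)
        (\<lambda>pc r. pc = 49 \<and> flags (rounds nverts edge owned1 nverts) r \<and> r 4 = 0)"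
      by - ((rule prog_step, simp, simp, simp add: trap_prog_def, simp)+,
          rule reaches_done, use inv in \<open>simp add: flags_def\<close>)
  qed simp_all
  have main: "reaches trap_prog w (nverts * ((18 * nverts + 20) * nverts + 7) + 7 * nverts + 7) (4, r) ?Q"
    if "flags (rounds nverts edge owned1 0) r \<and> r 3 = nverts" for r
    by (rule reaches_trans[OF round_loop[OF conjunct1[OF that] conjunct2[OF that]] final]) simp_all
  show ?thesis
    by (rule reaches_trans[OF init main]) simp_all
qed

end

section \<open>Correctness on encoded games\<close>

text \<open>A sole successor must have probability 1: at chance vertices because the row sums to 1,
  elsewhere because the entries are 0 or 1. So terminality depends on signs only.\<close>

lemma terminal_iff_post:
  assumes G: "stochastic_game G" and u: "u \<in> verts G"
  shows "u \<in> terminal G \<longleftrightarrow> (\<forall>y\<in>post G u. y = u)"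
proof
  show "u \<in> terminal G \<Longrightarrow> \<forall>y\<in>post G u. y = u"
    by (auto simp: terminal_def post_def)
next
  assume only: "\<forall>y\<in>post G u. y = u"
  have zero: "trans_prob G u y = 0" if "y \<in> verts G" "y \<noteq> u" for y
  proof -
    have "0 \<le> trans_prob G u y" using G u that by (auto simp: stochastic_game_def)
    moreover have "\<not> 0 < trans_prob G u y" using only that by (auto simp: post_def)
    ultimately show ?thesis by simp
  qed
  have "post G u \<noteq> {}" using G u by (auto simp: stochastic_game_def)
  with only have pos: "0 < trans_prob G u u" by (auto simp: post_def)
  have "trans_prob G u u = 1"
  proof (cases "u \<in> vertsP G")
    case True
    then have "(\<Sum>y\<in>verts G. trans_prob G u y) = 1" "finite (verts G)"
      using G by (auto simp: stochastic_game_def)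
    then show ?thesis
      using u zero by (simp add: sum.remove[of _ u])
  next
    case False
    then have "u \<in> verts1 G \<union> verts2 G" using G u by (auto simp: stochastic_game_def)
    then have "trans_prob G u u \<in> {0, 1}" using G u by (auto simp: stochastic_game_def)
    with pos show ?thesis by simp
  qed
  with u zero show "u \<in> terminal G" by (simp add: terminal_def)
qed

section \<open>Addresses in the encoded matrix\<close>

lemma length_concat_map_const:
  "(\<And>x. x \<in> set xs \<Longrightarrow> length (f x) = m) \<Longrightarrow> length (concat (map f xs)) = length xs * m"
  by (induction xs) auto

lemma nth_concat_map_const:
  "(\<And>x. x \<in> set xs \<Longrightarrow> length (f x) = m) \<Longrightarrow> i < length xs \<Longrightarrow> k < m \<Longrightarrow>
    concat (map f xs) ! (i * m + k) = f (xs ! i) ! k"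
proof (induction xs arbitrary: i)
  case (Cons x xs)
  show ?case
  proof (cases i)
    case 0
    then show ?thesis using Cons.prems by (simp add: nth_append)
  next
    case (Suc i')
    then have "concat (map f xs) ! (i' * m + k) = f (xs ! i') ! k"
      using Cons.prems by (intro Cons.IH) auto
    then show ?thesis using Suc Cons.prems(1)[of x] by (simp add: nth_append)
  qed
qed simp

lemma encodesE:
  assumes G: "stochastic_game G" and enc: "encodes w G"
  obtains vs where "distinct vs" "set vs = verts G" "nverts w = length vs" "length vs < length w"
    and "\<And>i. i < length vs \<Longrightarrow> owned1 w i \<longleftrightarrow> vs ! i \<in> verts1 G"
    and "\<And>i j. i < length vs \<Longrightarrow> j < length vs \<Longrightarrow> edge w i j \<longleftrightarrow> vs ! j \<in> post G (vs ! i)"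
proof -
  obtain vs num den where vs: "distinct vs" "set vs = verts G"
    and tr: "\<forall>v\<in>verts G. \<forall>v'\<in>verts G.
      den v v' > (0::nat) \<and> trans_prob G v v' = real (num v v') / real (den v v')"
    and w: "w = length vs # map (owner_tag G) vs @
      concat (map (\<lambda>v. concat (map (\<lambda>v'. [num v v', den v v']) vs)) vs)"
    using enc unfolding encodes_def by blast
  let ?N = "length vs"
  let ?row = "\<lambda>v. concat (map (\<lambda>v'. [num v v', den v v']) vs)"
  have row: "length (?row v) = ?N * 2" for v
    by (rule length_concat_map_const) simp
  have matrix: "length (concat (map ?row vs)) = ?N * (?N * 2)"
    using row by (rule length_concat_map_const)
  have nverts: "nverts w = ?N" by (simp add: inp_def w)
  have lt: "?N < length w" by (simp add: w)
  have owner: "inp w (i + 1) = owner_tag G (vs ! i)" if "i < ?N" for i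
    using that by (simp add: inp_def w nth_append)
  have num: "inp w (?N + 1 + 2 * (i * ?N + j)) = num (vs ! i) (vs ! j)" if i: "i < ?N" and j: "j < ?N" for i j
  proof -
    have j2: "j * 2 < ?N * 2" using j by simp
    \<comment> \<open>The address stays inside the word, so \<open>inp\<close> does not return its
      default 0.\<close>
    have "i * (?N * 2) + j * 2 < Suc i * (?N * 2)" using j by simp
    also have "\<dots> \<le> ?N * (?N * 2)" using i by (intro mult_right_mono) auto
    finally have less: "2 * (i * ?N + j) < ?N * (?N * 2)" by (simp add: algebra_simps)
    have "concat (map ?row vs) ! (i * (?N * 2) + j * 2) = ?row (vs ! i) ! (j * 2)"
      using row i j2 by (rule nth_concat_map_const)
    also have "\<dots> = num (vs ! i) (vs ! j)"
      using nth_concat_map_const[of vs "\<lambda>v'. [num (vs ! i) v', den (vs ! i) v']" 2 j 0] j by simp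
    finally have "concat (map ?row vs) ! (2 * (i * ?N + j)) = num (vs ! i) (vs ! j)"
      by (simp add: algebra_simps)
    moreover have "w ! (?N + 1 + 2 * (i * ?N + j)) = concat (map ?row vs) ! (2 * (i * ?N + j))"
      unfolding w by (simp add: nth_append)
    moreover have "?N + 1 + 2 * (i * ?N + j) < length w"
      using less matrix by (simp add: w)
    ultimately show ?thesis by (simp add: inp_def)
  qed
  show thesis
  proof (rule that[OF vs nverts lt])
    show "owned1 w i \<longleftrightarrow> vs ! i \<in> verts1 G" if "i < ?N" for i
      unfolding owned1_def owner[OF that] by (simp add: owner_tag_def)
    show "edge w i j \<longleftrightarrow> vs ! j \<in> post G (vs ! i)" if i: "i < ?N" and j: "j < ?N" for i j
    proof -
      have mem: "vs ! i \<in> verts G" "vs ! j \<in> verts G" using i j vs(2) nth_mem by blast+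
      show ?thesis
        unfolding edge_def nverts num[OF i j]
        using tr[rule_format, OF mem] mem(2) by (simp add: post_def zero_less_divide_iff)
    qed
  qed
qed

text \<open>The enumeration is a bijection between indices and vertices, under which traps become
  the index sets \<open>S\<close> with no member doomed by \<open>- S\<close>.\<close>

lemma stopping_iff_rounds_complete:
  assumes G: "stochastic_game G" and enc: "encodes w G"
  shows "stopping_under_fairness G \<longleftrightarrow>
    {..<nverts w} \<subseteq> rounds (nverts w) (edge w) (owned1 w) (nverts w)"
proof -
  obtain vs where vs: "distinct vs" "set vs = verts G" and N: "nverts w = length vs"
    and own: "\<And>i. i < length vs \<Longrightarrow> owned1 w i \<longleftrightarrow> vs ! i \<in> verts1 G"
    and edge: "\<And>i j. i < length vs \<Longrightarrow> j < length vs \<Longrightarrow> edge w i j \<longleftrightarrow> vs ! j \<in> post G (vs ! i)"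
    using encodesE[OF G enc] by metis
  let ?N = "length vs"
  have verts: "verts G = (!) vs ` {..<?N}"
    unfolding vs(2)[symmetric] set_conv_nth by auto
  have post: "(\<forall>y\<in>post G (vs ! i). Q y) \<longleftrightarrow> (\<forall>j<?N. edge w i j \<longrightarrow> Q (vs ! j))" if "i < ?N" for i Q
  proof -
    have "post G (vs ! i) = (!) vs ` {j. j < ?N \<and> edge w i j}"
      using edge[OF that] by (auto simp: post_def verts)
    then show ?thesis by auto
  qed
  have trap_image: "trap G ((!) vs ` S) \<longleftrightarrow> (\<forall>i\<in>S. \<not> doomed ?N (edge w) (owned1 w) (- S) i)"
    if S: "S \<subseteq> {..<?N}" for S
  proof -
    have mem: "vs ! j \<in> (!) vs ` S \<longleftrightarrow> j \<in> S" if "j < ?N" for j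
      using that S vs(1) by (auto simp: nth_eq_iff_index_eq)
    have step: "(vs ! i \<notin> terminal G \<and> (if vs ! i \<in> verts1 G then post G (vs ! i) \<inter> (!) vs ` S \<noteq> {}
        else post G (vs ! i) \<subseteq> (!) vs ` S)) \<longleftrightarrow> \<not> doomed ?N (edge w) (owned1 w) (- S) i"
      if "i \<in> S" for i
    proof -
      have i: "i < ?N" using that S by auto
      then have "vs ! i \<in> verts G" by (auto simp: verts)
      then have "vs ! i \<in> terminal G \<longleftrightarrow> (\<forall>j<?N. edge w i j \<longrightarrow> vs ! j = vs ! i)"
        using terminal_iff_post[OF G] post[OF i] by simp
      also have "\<dots> \<longleftrightarrow> (\<forall>j<?N. edge w i j \<longrightarrow> j = i)"
        using i vs(1) by (auto simp: nth_eq_iff_index_eq)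
      finally have terminal: "vs ! i \<in> terminal G \<longleftrightarrow> \<not> (\<exists>j<?N. edge w i j \<and> j \<noteq> i)" by blast
      have "post G (vs ! i) \<inter> (!) vs ` S = {} \<longleftrightarrow> (\<forall>y\<in>post G (vs ! i). y \<notin> (!) vs ` S)" by blast
      also have "\<dots> \<longleftrightarrow> (\<forall>j<?N. edge w i j \<longrightarrow> j \<notin> S)" using post[OF i] mem by simp
      finally have avoid: "post G (vs ! i) \<inter> (!) vs ` S = {} \<longleftrightarrow> (\<forall>j<?N. edge w i j \<longrightarrow> j \<notin> S)" .
      have "post G (vs ! i) \<subseteq> (!) vs ` S \<longleftrightarrow> (\<forall>y\<in>post G (vs ! i). y \<in> (!) vs ` S)" by blast
      also have "\<dots> \<longleftrightarrow> (\<forall>j<?N. edge w i j \<longrightarrow> j \<in> S)" using post[OF i] mem by simp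
      finally have closed: "post G (vs ! i) \<subseteq> (!) vs ` S \<longleftrightarrow> (\<forall>j<?N. edge w i j \<longrightarrow> j \<in> S)" .
      show ?thesis
        unfolding terminal avoid closed own[OF i, symmetric] doomed_def by auto
    qed
    have "(\<forall>u\<in>(!) vs ` S. u \<notin> terminal G \<and> (if u \<in> verts1 G then post G u \<inter> (!) vs ` S \<noteq> {}
        else post G u \<subseteq> (!) vs ` S)) \<longleftrightarrow> (\<forall>i\<in>S. \<not> doomed ?N (edge w) (owned1 w) (- S) i)"
      by (subst Set.ball_simps(9)) (rule ball_cong[OF refl step])
    moreover have "(!) vs ` S \<subseteq> verts G" using S unfolding verts by (rule image_mono)
    ultimately show ?thesis
      unfolding trap_def disjoint_iff ball_conj_distrib by (simp only: simp_thms Ball_def)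
  qed
  have "(\<forall>S. trap G S \<longrightarrow> S = {}) \<longleftrightarrow> (\<forall>S. S \<subseteq> {..<?N} \<longrightarrow> trap G ((!) vs ` S) \<longrightarrow> S = {})"
  proof (intro iffI allI impI)
    fix S assume all: "\<forall>S. S \<subseteq> {..<?N} \<longrightarrow> trap G ((!) vs ` S) \<longrightarrow> S = {}" and S: "trap G S"
    then have "S \<subseteq> (!) vs ` {..<?N}" by (simp add: trap_def verts)
    then obtain S' where "S' \<subseteq> {..<?N}" "S = (!) vs ` S'" by (meson subset_imageE)
    with all S show "S = {}" by auto
  qed auto
  also have "\<dots> \<longleftrightarrow> (\<forall>S. S \<subseteq> {..<?N} \<longrightarrow>
      (\<forall>i\<in>S. \<not> doomed ?N (edge w) (owned1 w) (- S) i) \<longrightarrow> S = {})"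
    by (simp add: trap_image cong: imp_cong)
  finally show ?thesis
    unfolding stopping_iff_no_trap[OF G] N rounds_complete_iff .
qed

section \<open>The cubic time bound\<close>

lemma ram_step_halted: "ram_halted P c \<Longrightarrow> (ram_step P w ^^ t) c = c"
  by (induction t) (simp_all add: ram_step_def)

lemma answers_within_if_reaches:
  assumes "reaches P w T (0, \<lambda>_. 0) (\<lambda>pc r. pc = length P \<and> r 0 = of_bool b)" "T \<le> T'"
  shows "answers_within P w T' b"
proof -
  obtain t r where t: "t \<le> T" and run: "(ram_step P w ^^ t) (0, \<lambda>_. 0) = (length P, r)"
    and r: "r 0 = of_bool b"
    using assms(1) by (elim reachesE) auto
  have "ram_run P w T' = (ram_step P w ^^ (T' - t)) ((ram_step P w ^^ t) (0, \<lambda>_. 0))"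
    using t assms(2) unfolding ram_run_def
    by (simp only: o_apply[symmetric, of "ram_step P w ^^ (T' - t)"] funpow_add[symmetric]) simp
  also have "\<dots> = (length P, r)"
    unfolding run by (rule ram_step_halted) (simp add: ram_halted_def)
  finally show ?thesis using r by (simp add: answers_within_def ram_halted_def)
qed

lemma length_le_input_size: "length w \<le> input_size w"
  by (induction w) (auto simp: input_size_def)

theorem theorem3:
  shows "\<exists>(P :: ram) (p :: nat poly). \<forall>(G :: nat game) (w :: nat list).
    stochastic_game G \<longrightarrow> encodes w G \<longrightarrow>
      answers_within P w (poly p (input_size w)) (stopping_under_fairness G)"
proof (intro exI allI impI)
  fix G :: "nat game" and w :: "nat list"
  assume G: "stochastic_game G" and enc: "encodes w G"
  let ?n = "nverts w"
  have "?n < length w" using encodesE[OF G enc] by metis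
  then have n: "?n + 1 \<le> input_size w" using length_le_input_size[of w] by simp
  \<comment> \<open>The left side expands to 18 n^3 + 20 n^2 + 14 n + 11, the right side to 20 n^3 +
    60 n^2 + 60 n + 20.\<close>
  have "?n * ((18 * ?n + 20) * ?n + 7) + 7 * ?n + 11 \<le> 20 * (?n + 1) ^ 3"
    by (simp add: power3_eq_cube algebra_simps)
  also have "\<dots> \<le> 20 * input_size w ^ 3"
    using n by (intro mult_left_mono power_mono) auto
  also have "\<dots> = poly (monom 20 3) (input_size w)"
    by (simp add: poly_monom)
  finally show "answers_within trap_prog w (poly (monom 20 3) (input_size w)) (stopping_under_fairness G)"
    using trap_prog_reaches[of w] unfolding stopping_iff_rounds_complete[OF G enc]
    by (intro answers_within_if_reaches) auto
qed

end
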